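(* Let $(S,\mu)$ and $(T,\nu)$ be positive measure spaces, let $1<p<\infty$, and let $f_1,g_1\in L^p(S,\mu)$ and $f_2,g_2\in L^p(T,\nu)$. Then $f_1\otimes f_2\perp_{BJ}g_1\otimes g_2$ in $L^p(S,\mu)\otimes^{\Delta_p}L^p(T,\nu)$ if and only if either $f_1\perp_{BJ}g_1$ or $f_2\perp_{BJ}g_2$.
   Context: The scalar field $\mathbb{F}$ is $\mathbb{R}$ or $\mathbb{C}$. For a normed space $Z$ over $\mathbb{F}$ and $u,v\in Z$, $u$ is Birkhoff-James orthogonal to $v$, written $u\perp_{BJ}v$, if $\|u+\alpha v\|\ge\|u\|$ for all $\alpha\in\mathbb{F}$. For a Banach space $X$, $L^p(\mu,X)$ denotes the space of Bochner $p$-integrable functions from $S$ to $X$. The norm $\Delta_p$ on the algebraic tensor product $L^p(S,\mu)\otimes X$ is $\|u\|_{\Delta_p}=\|\phi(u)\|_{L^p(\mu,X)}$, where $\phi:L^p(S,\mu)\otimes X\to L^p(\mu,X)$ is the injective linear map determined by $\phi(f\otimes x)=f(\cdot)x$. With $X=L^p(T,\nu)$, $L^p(S,\mu)\otimes^{\Delta_p}L^p(T,\nu)$ is the completion of $L^p(S,\mu)\otimes L^p(T,\nu)$ with respect to $\|\cdot\|_{\Delta_p}$. "Either ... or" is inclusive. *)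

theory Defs
  imports "HOL-Analysis.Analysis" "HOL-Library.Poly_Mapping"
begin

section \<open>Vector spaces and normed spaces with explicit carriers\<close>

text \<open>
  \<open>L\<^sup>p\<close>-spaces depend on a measure and on an exponent, that is, on terms, so they cannot be types of
  the class \<open>real_normed_vector\<close>. Vector spaces over the type \<open>'k\<close> of scalars are therefore
  records with a carrier set.
\<close>

record ('k, 'v) vect_space =
  carrier :: "'v set"
  vadd :: "'v \<Rightarrow> 'v \<Rightarrow> 'v"
  vzero :: "'v"
  vscale :: "'k \<Rightarrow> 'v \<Rightarrow> 'v"

record ('k, 'v) norm_space = "('k, 'v) vect_space" +
  vnorm :: "'v \<Rightarrow> real"

definition vsub :: "('k::ring_1, 'v, 'm) vect_space_scheme \<Rightarrow> 'v \<Rightarrow> 'v \<Rightarrow> 'v" where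
  "vsub V x y = vadd V x (vscale V (-1) y)"

definition with_norm ::
  "('k, 'v) vect_space \<Rightarrow> ('v \<Rightarrow> real) \<Rightarrow> ('k, 'v) norm_space" where
  "with_norm V n =
     \<lparr>carrier = carrier V, vadd = vadd V, vzero = vzero V, vscale = vscale V, vnorm = n\<rparr>"

definition BJ_orthogonal :: "('k, 'v) norm_space \<Rightarrow> 'v \<Rightarrow> 'v \<Rightarrow> bool" where
  "BJ_orthogonal Z u v \<longleftrightarrow> (\<forall>\<alpha>. vnorm Z (vadd Z u (vscale Z \<alpha> v)) \<ge> vnorm Z u)"

definition is_linear ::
  "('k, 'v, 'm) vect_space_scheme \<Rightarrow> ('k, 'w, 'n) vect_space_scheme \<Rightarrow> ('v \<Rightarrow> 'w) \<Rightarrow> bool" where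
  "is_linear V W h \<longleftrightarrow>
     (\<forall>x\<in>carrier V. h x \<in> carrier W) \<and>
     (\<forall>x\<in>carrier V. \<forall>y\<in>carrier V. h (vadd V x y) = vadd W (h x) (h y)) \<and>
     (\<forall>a. \<forall>x\<in>carrier V. h (vscale V a x) = vscale W a (h x))"


section \<open>Quotients by subspaces\<close>

definition coset :: "('k::ring_1, 'v, 'm) vect_space_scheme \<Rightarrow> 'v set \<Rightarrow> 'v \<Rightarrow> 'v set" where
  "coset V N x = {y \<in> carrier V. vsub V y x \<in> N}"

definition quot_space ::
  "('k::ring_1, 'v, 'm) vect_space_scheme \<Rightarrow> 'v set \<Rightarrow> ('k, 'v set) vect_space" where
  "quot_space V N =
     \<lparr>carrier = coset V N ` carrier V,
      vadd = (\<lambda>A B. \<Union>a\<in>A. \<Union>b\<in>B. coset V N (vadd V a b)),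
      vzero = coset V N (vzero V),
      vscale = (\<lambda>k A. \<Union>a\<in>A. coset V N (vscale V k a))\<rparr>"

text \<open>
  The next definition is used only when \<^const>\<open>vnorm\<close> is a seminorm vanishing on \<open>N\<close>. The
  seminorm is then constant on every coset, and \<^const>\<open>the_elem\<close> picks its value there.
\<close>

definition norm_quot_space ::
  "('k::ring_1, 'v) norm_space \<Rightarrow> 'v set \<Rightarrow> ('k, 'v set) norm_space" where
  "norm_quot_space V N = with_norm (quot_space V N) (\<lambda>A. the_elem (vnorm V ` A))"


section \<open>Completion of a normed space\<close>

text \<open>Cauchy sequences, with the seminorm \<open>lim \<parallel>\<sigma> n\<parallel>\<close>, modulo null sequences.\<close>

definition cauchy_space :: "('k::ring_1, 'v) norm_space \<Rightarrow> ('k, nat \<Rightarrow> 'v) norm_space" where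
  "cauchy_space Z =
     \<lparr>carrier = {\<sigma>. (\<forall>n. \<sigma> n \<in> carrier Z) \<and>
         (\<forall>e>0. \<exists>n0. \<forall>m\<ge>n0. \<forall>n\<ge>n0. vnorm Z (vsub Z (\<sigma> m) (\<sigma> n)) < e)},
      vadd = (\<lambda>\<sigma> \<tau> n. vadd Z (\<sigma> n) (\<tau> n)),
      vzero = (\<lambda>n. vzero Z),
      vscale = (\<lambda>a \<sigma> n. vscale Z a (\<sigma> n)),
      vnorm = (\<lambda>\<sigma>. lim (\<lambda>n. vnorm Z (\<sigma> n)))\<rparr>"

definition null_seqs :: "('k::ring_1, 'v) norm_space \<Rightarrow> (nat \<Rightarrow> 'v) set" where
  "null_seqs Z = {\<sigma>. (\<forall>n. \<sigma> n \<in> carrier Z) \<and> (\<lambda>n. vnorm Z (\<sigma> n)) \<longlonglongrightarrow> 0}"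

definition norm_completion :: "('k::ring_1, 'v) norm_space \<Rightarrow> ('k, (nat \<Rightarrow> 'v) set) norm_space" where
  "norm_completion Z = norm_quot_space (cauchy_space Z) (null_seqs Z)"

definition to_completion :: "('k::ring_1, 'v) norm_space \<Rightarrow> 'v \<Rightarrow> (nat \<Rightarrow> 'v) set" where
  "to_completion Z x = coset (cauchy_space Z) (null_seqs Z) (\<lambda>n. x)"


section \<open>Lebesgue and Bochner \<open>L\<^sup>p\<close>-spaces\<close>

definition Lp_funs :: "'s measure \<Rightarrow> real \<Rightarrow> ('k::real_normed_field, 's \<Rightarrow> 'k) norm_space" where
  "Lp_funs M p =
     \<lparr>carrier = {f \<in> borel_measurable M. integrable M (\<lambda>s. norm (f s) powr p)},
      vadd = (\<lambda>f g s. f s + g s),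
      vzero = (\<lambda>s. 0),
      vscale = (\<lambda>a f s. a * f s),
      vnorm = (\<lambda>f. (\<integral>s. norm (f s) powr p \<partial>M) powr (1 / p))\<rparr>"

definition Lp :: "'s measure \<Rightarrow> real \<Rightarrow> ('k::real_normed_field, ('s \<Rightarrow> 'k) set) norm_space" where
  "Lp M p = norm_quot_space (Lp_funs M p) {f \<in> carrier (Lp_funs M p). AE s in M. f s = 0}"

text \<open>
  Strong measurability is usually required only up to a null set. Such a function agrees almost
  everywhere with one that is strongly measurable in the everywhere sense below, so the space of
  classes is the same, and \<open>s \<mapsto> \<parallel>u s\<parallel>\<close> is measurable also when \<open>M\<close> is not complete.
\<close>

definition strongly_measurable ::
  "'s measure \<Rightarrow> ('k::ring_1, 'v) norm_space \<Rightarrow> ('s \<Rightarrow> 'v) \<Rightarrow> bool" where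
  "strongly_measurable M X u \<longleftrightarrow> u \<in> space M \<rightarrow> carrier X \<and>
     (\<exists>\<phi>. (\<forall>n. simple_function M (\<phi> n) \<and> \<phi> n \<in> space M \<rightarrow> carrier X) \<and>
          (\<forall>s\<in>space M. (\<lambda>n. vnorm X (vsub X (\<phi> n s) (u s))) \<longlonglongrightarrow> 0))"

definition Bochner_Lp_funs ::
  "'s measure \<Rightarrow> real \<Rightarrow> ('k::ring_1, 'v) norm_space \<Rightarrow> ('k, 's \<Rightarrow> 'v) norm_space" where
  "Bochner_Lp_funs M p X =
     \<lparr>carrier = {u. strongly_measurable M X u \<and> integrable M (\<lambda>s. vnorm X (u s) powr p)},
      vadd = (\<lambda>u v s. vadd X (u s) (v s)),
      vzero = (\<lambda>s. vzero X),
      vscale = (\<lambda>a u s. vscale X a (u s)),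
      vnorm = (\<lambda>u. (\<integral>s. vnorm X (u s) powr p \<partial>M) powr (1 / p))\<rparr>"

definition Bochner_null_funs ::
  "'s measure \<Rightarrow> real \<Rightarrow> ('k::ring_1, 'v) norm_space \<Rightarrow> ('s \<Rightarrow> 'v) set" where
  "Bochner_null_funs M p X = {u \<in> carrier (Bochner_Lp_funs M p X). AE s in M. u s = vzero X}"

definition Bochner_Lp ::
  "'s measure \<Rightarrow> real \<Rightarrow> ('k::ring_1, 'v) norm_space \<Rightarrow> ('k, ('s \<Rightarrow> 'v) set) norm_space" where
  "Bochner_Lp M p X = norm_quot_space (Bochner_Lp_funs M p X) (Bochner_null_funs M p X)"


section \<open>Algebraic tensor product\<close>

definition free_scale :: "'k::field \<Rightarrow> ('b \<Rightarrow>\<^sub>0 'k) \<Rightarrow> ('b \<Rightarrow>\<^sub>0 'k)" where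
  "free_scale a c = Poly_Mapping.map ((*) a) c"

lemma lookup_free_scale [simp]: "Poly_Mapping.lookup (free_scale a c) b = a * Poly_Mapping.lookup c b"
  by (simp add: free_scale_def Poly_Mapping.map.rep_eq when_def)

lemma vector_space_free_scale: "vector_space free_scale"
  by unfold_locales
    (auto intro!: poly_mapping_eqI simp: lookup_add algebra_simps)

definition free_space :: "'b set \<Rightarrow> ('k::field, 'b \<Rightarrow>\<^sub>0 'k) vect_space" where
  "free_space B =
     \<lparr>carrier = {c. Poly_Mapping.keys c \<subseteq> B}, vadd = (+), vzero = 0, vscale = free_scale\<rparr>"

definition tensor_relators ::
  "('k::field, 'v, 'm) vect_space_scheme \<Rightarrow> ('k, 'w, 'n) vect_space_scheme \<Rightarrow> (('v \<times> 'w) \<Rightarrow>\<^sub>0 'k) set"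
  where
  "tensor_relators V W =
     (let e = (\<lambda>x y. Poly_Mapping.single (x, y) 1) in
       {e (vadd V x x') y - e x y - e x' y | x x' y.
          x \<in> carrier V \<and> x' \<in> carrier V \<and> y \<in> carrier W} \<union>
       {e x (vadd W y y') - e x y - e x y' | x y y'.
          x \<in> carrier V \<and> y \<in> carrier W \<and> y' \<in> carrier W} \<union>
       {e (vscale V a x) y - free_scale a (e x y) | a x y. x \<in> carrier V \<and> y \<in> carrier W} \<union>
       {e x (vscale W a y) - free_scale a (e x y) | a x y. x \<in> carrier V \<and> y \<in> carrier W})"

definition tensor_space ::
  "('k::field, 'v, 'm) vect_space_scheme \<Rightarrow> ('k, 'w, 'n) vect_space_scheme \<Rightarrow>
     ('k, (('v \<times> 'w) \<Rightarrow>\<^sub>0 'k) set) vect_space" where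
  "tensor_space V W = quot_space (free_space (carrier V \<times> carrier W))
     (module.span free_scale (tensor_relators V W))"

definition tensor ::
  "('k::field, 'v, 'm) vect_space_scheme \<Rightarrow> ('k, 'w, 'n) vect_space_scheme \<Rightarrow> 'v \<Rightarrow> 'w \<Rightarrow>
     (('v \<times> 'w) \<Rightarrow>\<^sub>0 'k) set" where
  "tensor V W x y = coset (free_space (carrier V \<times> carrier W))
     (module.span free_scale (tensor_relators V W)) (Poly_Mapping.single (x, y) 1)"


section \<open>The norm \<open>\<Delta>\<^sub>p\<close>\<close>

text \<open>The class of \<open>s \<mapsto> f s \<cdot> x\<close>, for any representative \<open>f\<close> of \<open>F\<close>.\<close>

definition Lp_times ::
  "'s measure \<Rightarrow> real \<Rightarrow> ('k::real_normed_field, 'v) norm_space \<Rightarrow> ('s \<Rightarrow> 'k) set \<Rightarrow> 'v \<Rightarrow> ('s \<Rightarrow> 'v) set"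
  where
  "Lp_times M p X F x =
     (\<Union>f\<in>F. coset (Bochner_Lp_funs M p X) (Bochner_null_funs M p X) (\<lambda>s. vscale X (f s) x))"

text \<open>
  The canonical map \<open>\<phi> : L\<^sup>p(M) \<otimes> X \<rightarrow> L\<^sup>p(M, X)\<close>. The two conditions determine it on the carrier,
  because the elementary tensors span the tensor product.
\<close>

definition tensor_to_Bochner ::
  "'s measure \<Rightarrow> real \<Rightarrow> ('k::real_normed_field, 'v) norm_space \<Rightarrow>
     ((('s \<Rightarrow> 'k) set \<times> 'v) \<Rightarrow>\<^sub>0 'k) set \<Rightarrow> ('s \<Rightarrow> 'v) set" where
  "tensor_to_Bochner M p X =
     (SOME \<phi>. is_linear (tensor_space (Lp M p) X) (Bochner_Lp M p X) \<phi> \<and>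
        (\<forall>F\<in>carrier (Lp M p). \<forall>x\<in>carrier X. \<phi> (tensor (Lp M p) X F x) = Lp_times M p X F x))"

definition Delta_tensor ::
  "'s measure \<Rightarrow> real \<Rightarrow> ('k::real_normed_field, 'v) norm_space \<Rightarrow>
     ('k, ((('s \<Rightarrow> 'k) set \<times> 'v) \<Rightarrow>\<^sub>0 'k) set) norm_space" where
  "Delta_tensor M p X = with_norm (tensor_space (Lp M p) X)
     (\<lambda>u. vnorm (Bochner_Lp M p X) (tensor_to_Bochner M p X u))"

definition Delta_completion ::
  "'s measure \<Rightarrow> real \<Rightarrow> ('k::real_normed_field, 'v) norm_space \<Rightarrow>
     ('k, (nat \<Rightarrow> ((('s \<Rightarrow> 'k) set \<times> 'v) \<Rightarrow>\<^sub>0 'k) set) set) norm_space" where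
  "Delta_completion M p X = norm_completion (Delta_tensor M p X)"

text \<open>The elementary tensor \<open>F \<otimes> x\<close> as an element of the completion of \<open>L\<^sup>p(M) \<otimes> X\<close>.\<close>

definition Delta_elem ::
  "'s measure \<Rightarrow> real \<Rightarrow> ('k::real_normed_field, 'v) norm_space \<Rightarrow> ('s \<Rightarrow> 'k) set \<Rightarrow> 'v \<Rightarrow>
     (nat \<Rightarrow> ((('s \<Rightarrow> 'k) set \<times> 'v) \<Rightarrow>\<^sub>0 'k) set) set" where
  "Delta_elem M p X F x = to_completion (Delta_tensor M p X) (tensor (Lp M p) X F x)"

end

theory Submission
  imports Defs
begin

text \<open>
  Write \<open>J a = |a|\<^sup>p / a\<close>, which is \<open>|a|\<^sup>p\<^sup>-\<^sup>2\<close> times the conjugate of \<open>a\<close>. The convex function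
  \<open>\<alpha> \<mapsto> \<integral>|f + \<alpha> g|\<^sup>p\<close> has the derivative \<open>p Re (\<alpha> \<integral> J(f) g)\<close> at \<open>0\<close> in direction \<open>\<alpha>\<close>,
  so \<open>f \<bottom> g\<close> in \<open>L\<^sup>p\<close> iff
  \<open>\<integral> J(f) g = 0\<close>. The norm of \<open>f\<^sub>1 \<otimes> f\<^sub>2 + \<alpha> g\<^sub>1 \<otimes> g\<^sub>2\<close> is an iterated integral.
  As \<open>J\<close> is multiplicative, the same
  argument applied twice shows that orthogonality of the tensors means
  \<open>\<integral> J(f\<^sub>1) g\<^sub>1 \<cdot> \<integral> J(f\<^sub>2) g\<^sub>2 = 0\<close>. The two integrals never have to be exchanged, so no
  \<open>\<sigma>\<close>-finiteness is needed.

  Real and complex scalars are treated at once as a normed field which is also a Euclidean space;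
  there \<^term>\<open>inner 1 z\<close> is the real part of \<open>z\<close>.
\<close>

section \<open>Convexity of powers and the Minkowski inequality\<close>

text \<open>The delicate point is differentiation under the outer integral. Along the steps
  \<open>1 / (n + 1)\<close> the difference quotients of a convex function lie between its
  derivative and its increment over the full step. Both bounds are integrable, so dominated
  convergence applies to the inner and to the outer integral in the same way. The inner integral
  must also be measurable in the outer variable. It is the \<open>p\<close>-th power of the norm of
  \<open>f\<^sub>1(s) f\<^sub>2 + \<alpha> g\<^sub>1(s) g\<^sub>2\<close> in the second space, and
  the norm of a strongly measurable function is measurable; this takes the place of a Fubini
  argument. The condition \<open>p > 1\<close> enters where \<open>f\<close> vanishes: there
  \<open>|t b|^p / t\<close> tends to \<open>0\<close>, which agrees with \<open>J 0 = 0\<close>.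
  Quotients, tensor product and completion come in only through the elements
  \<open>x + \<alpha> y\<close> with \<open>x\<close>, \<open>y\<close> fixed, so each layer reduces
  orthogonality to an inequality between norms of representatives one layer below.\<close>

lemma powr_convex_nonneg:
  fixes x y u p :: real
  assumes "1 \<le> p" "0 \<le> x" "0 \<le> y" "0 \<le> u" "u \<le> 1"
  shows "(u * x + (1 - u) * y) powr p \<le> u * x powr p + (1 - u) * y powr p"
proof -
  \<comment> \<open>If \<open>x\<close> or \<open>y\<close> is \<open>0\<close>, one summand
    disappears and the claim becomes this inequality, which rests on \<open>v powr p \<le> v\<close>
    for \<open>v\<close> between \<open>0\<close> and \<open>1\<close>. For positive arguments
    \<open>powr_convex\<close> applies.\<close>
  have *: "(v * z) powr p \<le> v * z powr p" if "0 \<le> v" "v \<le> 1" "0 \<le> z" for v z :: real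
  proof -
    have "v powr p \<le> v powr 1" if "0 < v"
      using that \<open>v \<le> 1\<close> assms(1) by (simp add: powr_le_one_le)
    then have "v powr p \<le> v"
      using that by (cases "v = 0") auto
    then show ?thesis
      using that by (simp add: powr_mult mult_right_mono)
  qed
  consider "x = 0" | "y = 0" | "0 < x" "0 < y"
    using assms by fastforce
  then show ?thesis
  proof cases
    case 1
    then show ?thesis using *[of "1 - u" y] assms by simp
  next
    case 2
    then show ?thesis using *[of u x] assms by simp
  next
    case 3
    have "convex_on {0<..} (\<lambda>x::real. x powr p)"
      using assms(1) by (rule powr_convex)
    from convex_onD[OF this, of "1 - u" x y] show ?thesis
      using assms 3 by simp
  qed
qed

lemma integrable_add_powr:
  fixes a b :: "'a \<Rightarrow> real"
  assumes "0 \<le> p"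
    and [measurable]: "a \<in> borel_measurable M" "b \<in> borel_measurable M"
    and nn: "\<And>s. s \<in> space M \<Longrightarrow> 0 \<le> a s" "\<And>s. s \<in> space M \<Longrightarrow> 0 \<le> b s"
    and int: "integrable M (\<lambda>s. a s powr p)" "integrable M (\<lambda>s. b s powr p)"
  shows "integrable M (\<lambda>s. (a s + b s) powr p)"
proof (rule Bochner_Integration.integrable_bound)
  show "integrable M (\<lambda>s. 2 powr p * (a s powr p + b s powr p))"
    using int by auto
  have "(x + y) powr p \<le> 2 powr p * (x powr p + y powr p)" if "0 \<le> x" "0 \<le> y" for x y :: real
  proof -
    have "(x + y) powr p \<le> (2 * max x y) powr p"
      using that assms(1) by (intro powr_mono2) auto
    also have "\<dots> = 2 powr p * max x y powr p"
      using that by (simp add: powr_mult)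
    also have "\<dots> \<le> 2 powr p * (x powr p + y powr p)"
      by (intro mult_left_mono) (auto simp: max_def)
    finally show ?thesis .
  qed
  then show "AE s in M. norm ((a s + b s) powr p) \<le> norm (2 powr p * (a s powr p + b s powr p))"
    using nn by (intro AE_I2) (simp add: abs_of_nonneg)
qed measurable

text \<open>With weights \<open>A / (A + B)\<close> and \<open>B / (A + B)\<close>, the sum
  \<open>a + b\<close> is \<open>A + B\<close> times a convex combination of \<open>a / A\<close>
  and \<open>b / B\<close>, whose \<open>p\<close>-th powers have integral at most \<open>1\<close>;
  convexity of the power does the rest. Positive upper bounds stand in for the norms, which may
  vanish and could then not be divisors.\<close>

lemma Minkowski_integral_bound:
  fixes a b :: "'a \<Rightarrow> real"
  assumes "1 \<le> p"
    and [measurable]: "a \<in> borel_measurable M" "b \<in> borel_measurable M"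
    and nn: "\<And>s. s \<in> space M \<Longrightarrow> 0 \<le> a s" "\<And>s. s \<in> space M \<Longrightarrow> 0 \<le> b s"
    and int: "integrable M (\<lambda>s. a s powr p)" "integrable M (\<lambda>s. b s powr p)"
    and A: "0 < A" "(\<integral>s. a s powr p \<partial>M) \<le> A powr p"
    and B: "0 < B" "(\<integral>s. b s powr p \<partial>M) \<le> B powr p"
  shows "(\<integral>s. (a s + b s) powr p \<partial>M) \<le> (A + B) powr p"
proof -
  define u where "u = A / (A + B)"
  have u: "0 \<le> u" "u \<le> 1" "(A + B) * u = A" "(A + B) * (1 - u) = B"
    using A B by (auto simp: u_def field_simps)
  define c where "c = (A + B) powr p"
  have pt: "(a s + b s) powr p \<le>
      c * u / A powr p * a s powr p + c * (1 - u) / B powr p * b s powr p" if "s \<in> space M" for s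
  proof -
    have "a s + b s = (A + B) * (u * (a s / A) + (1 - u) * (b s / B))"
    proof -
      have "(A + B) * (u * (a s / A) + (1 - u) * (b s / B))
          = ((A + B) * u) * (a s / A) + ((A + B) * (1 - u)) * (b s / B)"
        by (simp only: distrib_left mult.assoc)
      then show ?thesis using A B by (simp only: u) simp
    qed
    then have "(a s + b s) powr p = c * (u * (a s / A) + (1 - u) * (b s / B)) powr p"
      using A B u nn[OF that] by (simp add: powr_mult c_def)
    also have "\<dots> \<le> c * (u * (a s / A) powr p + (1 - u) * (b s / B) powr p)"
      using A B u nn[OF that] assms(1)
      by (intro mult_left_mono powr_convex_nonneg) (auto simp: c_def)
    also have "\<dots> = c * u / A powr p * a s powr p + c * (1 - u) / B powr p * b s powr p"
      using A B nn[OF that] by (simp add: powr_divide algebra_simps)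
    finally show ?thesis .
  qed
  have "(\<integral>s. (a s + b s) powr p \<partial>M) \<le>
      (\<integral>s. c * u / A powr p * a s powr p + c * (1 - u) / B powr p * b s powr p \<partial>M)"
    using assms(1) nn int pt by (intro integral_mono integrable_add_powr) auto
  also have "\<dots> = c * u / A powr p * (\<integral>s. a s powr p \<partial>M) + c * (1 - u) / B powr p * (\<integral>s. b s powr p \<partial>M)"
    using int by simp
  also have "\<dots> \<le> c * u / A powr p * A powr p + c * (1 - u) / B powr p * B powr p"
    using A B u by (intro add_mono mult_left_mono) (auto simp: c_def)
  also have "\<dots> = c * u + c * (1 - u)"
    using A B by simp
  also have "\<dots> = c"
    by (simp add: algebra_simps)
  finally show ?thesis by (simp add: c_def)
qed

lemma Minkowski_inequality:
  fixes a b :: "'a \<Rightarrow> real"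
  assumes "1 \<le> p"
    and "a \<in> borel_measurable M" "b \<in> borel_measurable M"
    and "\<And>s. s \<in> space M \<Longrightarrow> 0 \<le> a s" "\<And>s. s \<in> space M \<Longrightarrow> 0 \<le> b s"
    and "integrable M (\<lambda>s. a s powr p)" "integrable M (\<lambda>s. b s powr p)"
  shows "(\<integral>s. (a s + b s) powr p \<partial>M) powr (1 / p)
    \<le> (\<integral>s. a s powr p \<partial>M) powr (1 / p) + (\<integral>s. b s powr p \<partial>M) powr (1 / p)"
proof (rule field_le_epsilon)
  fix e :: real
  assume "0 < e"
  \<comment> \<open>The summand \<open>e / 2\<close> makes the bound positive even if the norm is
    \<open>0\<close>.\<close>
  define A where "A = (\<integral>s. a s powr p \<partial>M) powr (1 / p) + e / 2"
  define B where "B = (\<integral>s. b s powr p \<partial>M) powr (1 / p) + e / 2"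
  have pos: "0 < A" "0 < B"
    using \<open>0 < e\<close> by (auto simp: A_def B_def intro: add_nonneg_pos)
  have le: "I \<le> (I powr (1 / p) + e / 2) powr p" if "0 \<le> I" for I :: real
  proof -
    have "I = (I powr (1 / p)) powr p"
      using that assms(1) by (simp add: powr_powr)
    also have "\<dots> \<le> (I powr (1 / p) + e / 2) powr p"
      using assms(1) \<open>0 < e\<close> by (intro powr_mono2) auto
    finally show ?thesis .
  qed
  have "(\<integral>s. (a s + b s) powr p \<partial>M) \<le> (A + B) powr p"
    using assms pos by (intro Minkowski_integral_bound) (auto simp: A_def B_def intro!: le)
  then have "(\<integral>s. (a s + b s) powr p \<partial>M) powr (1 / p) \<le> ((A + B) powr p) powr (1 / p)"
    using assms(1) by (intro powr_mono2) auto
  also have "\<dots> = A + B"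
    using pos assms(1) by (simp add: powr_powr)
  finally show "(\<integral>s. (a s + b s) powr p \<partial>M) powr (1 / p)
      \<le> (\<integral>s. a s powr p \<partial>M) powr (1 / p) + (\<integral>s. b s powr p \<partial>M) powr (1 / p) + e"
    by (simp add: A_def B_def)
qed

text \<open>Bernoulli's inequality, obtained as the weighted arithmetic-geometric mean inequality
  for \<open>(1 + x) powr p\<close> and \<open>1\<close> with weights \<open>1 / p\<close> and
  \<open>1 - 1 / p\<close>, that is, from convexity of \<open>exp\<close> between
  \<open>p * ln (1 + x)\<close> and \<open>0\<close>.\<close>

lemma one_plus_powr_ge:
  fixes x p :: real
  assumes "1 \<le> p" "0 \<le> 1 + x"
  shows "1 + p * x \<le> (1 + x) powr p"
proof -
  have "1 + x \<le> 1 / p * (1 + x) powr p + (1 - 1 / p)"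
  proof (cases "1 + x = 0")
    case False
    have "exp ((1 - (1 - 1 / p)) *\<^sub>R (p * ln (1 + x)) + (1 - 1 / p) *\<^sub>R 0)
        \<le> (1 - (1 - 1 / p)) * exp (p * ln (1 + x)) + (1 - 1 / p) * exp 0"
      using assms by (intro convex_onD[OF exp_convex]) auto
    then show ?thesis using False assms by (simp add: powr_def)
  qed (use assms in simp)
  then have "p * (1 + x) \<le> p * (1 / p * (1 + x) powr p + (1 - 1 / p))"
    using assms by (intro mult_left_mono) auto
  also have "\<dots> = (1 + x) powr p + (p - 1)"
    using assms by (simp add: distrib_left right_diff_distrib)
  finally show ?thesis by (simp add: algebra_simps)
qed

section \<open>Directional derivatives of the \<open>L\<^sup>p\<close> norm\<close>

text \<open>The map \<open>J\<close> of the overview. Written as a quotient it involves no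
  conjugation, makes sense in every normed field and is visibly multiplicative. Division by zero
  gives it the value \<open>0\<close> at \<open>0\<close>, the correct one for
  \<open>p > 1\<close>.\<close>

definition duality :: "real \<Rightarrow> 'k \<Rightarrow> 'k::real_normed_field" where
  "duality p a = of_real (norm a powr p) / a"

lemma duality_mult: "duality p (a * b) = duality p a * duality p b"
  by (simp add: duality_def norm_mult powr_mult)

text \<open>Pulling out the size of \<open>a\<close> turns estimates near \<open>a\<close> into
  estimates near \<open>1\<close> in terms of the relative increment \<open>b / a\<close>.\<close>

lemma inner_one_duality:
  fixes a b :: "'k::{real_normed_field, real_inner}"
  shows "inner 1 (duality p a * b) = norm a powr p * inner 1 (b / a)"
proof -
  have "duality p a * b = norm a powr p *\<^sub>R (b / a)"
    by (simp add: duality_def scaleR_conv_of_real)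
  then show ?thesis by simp
qed

text \<open>The majorant is chosen so that integrability of the pairing of \<open>f\<close> and
  \<open>g\<close> follows from closure of L^p under sums, in place of Hoelder's inequality.\<close>

lemma norm_duality_le:
  assumes "1 \<le> p"
  shows "norm (duality p a * b) \<le> (norm a + norm b) powr p"
proof (cases "a = 0")
  case False
  have "norm (duality p a * b) = norm a powr (p - 1) * norm b"
    using False by (simp add: duality_def norm_mult norm_divide powr_diff)
  also have "\<dots> \<le> (norm a + norm b) powr (p - 1) * (norm a + norm b)"
    using assms by (intro mult_mono powr_mono2) auto
  also have "\<dots> = (norm a + norm b) powr p"
    using False by (simp add: powr_diff)
  finally show ?thesis .
qed (simp add: duality_def)

lemma borel_measurable_duality [measurable]:
  "(duality p :: 'k::{real_normed_field, euclidean_space} \<Rightarrow> 'k) \<in> borel_measurable borel"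
  unfolding duality_def[abs_def] divide_inverse by measurable

text \<open>The chord bound for the convex function \<open>t \<mapsto> norm (a + t b) powr p\<close>
  on the unit interval; it is what bounds difference quotients from above by the increment at
  \<open>t = 1\<close>.\<close>

lemma convex_norm_powr:
  fixes a b :: "'k::real_normed_field"
  assumes "1 \<le> p" "0 \<le> t" "t \<le> 1"
  shows "norm (a + of_real t * b) powr p \<le> norm a powr p + t * (norm (a + b) powr p - norm a powr p)"
proof -
  have "a + of_real t * b = of_real t * (a + b) + of_real (1 - t) * a"
    by (simp add: algebra_simps)
  then have "norm (a + of_real t * b) \<le> norm (of_real t * (a + b)) + norm (of_real (1 - t) * a)"
    by (metis norm_triangle_ineq)
  also have "\<dots> = t * norm (a + b) + (1 - t) * norm a"
    using assms by (simp add: norm_mult flip: of_real_diff)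
  finally have "norm (a + of_real t * b) powr p \<le> (t * norm (a + b) + (1 - t) * norm a) powr p"
    using assms by (intro powr_mono2) auto
  also have "\<dots> \<le> t * norm (a + b) powr p + (1 - t) * norm a powr p"
    using assms by (intro powr_convex_nonneg) auto
  finally show ?thesis by (simp add: algebra_simps)
qed

text \<open>Division by \<open>norm a powr p\<close> moves the base point to \<open>1\<close>. There
  Cauchy-Schwarz gives \<open>norm (1 + w) \<ge> 1 + Re w\<close>, and Bernoulli's inequality
  converts this into an affine lower bound for the \<open>p\<close>-th power.\<close>

lemma norm_powr_subgradient:
  fixes a b :: "'k::{real_normed_field, real_inner}"
  assumes "1 \<le> p"
  shows "norm a powr p + p * inner 1 (duality p a * b) \<le> norm (a + b) powr p"
proof (cases "a = 0")
  case False
  define w where "w = b / a"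
  define x where "x = inner 1 w"
  have "1 + p * x \<le> norm (1 + w) powr p"
  proof (cases "0 \<le> 1 + x")
    case True
    have "inner 1 (1 + w) \<le> norm (1::'k) * norm (1 + w)"
      by (rule norm_cauchy_schwarz)
    then have "1 + x \<le> norm (1 + w)"
      by (simp add: x_def inner_add_right flip: power2_norm_eq_inner)
    then have "(1 + x) powr p \<le> norm (1 + w) powr p"
      using True assms by (intro powr_mono2) auto
    with one_plus_powr_ge[OF assms True] show ?thesis by linarith
  next
    case False
    then have "p * x \<le> 1 * x"
      using assms by (intro mult_right_mono_neg) auto
    with False have "1 + p * x \<le> 0" by linarith
    then show ?thesis
      using powr_ge_zero[of "norm (1 + w)" p] by linarith
  qed
  then have "norm a powr p * (1 + p * x) \<le> norm a powr p * norm (1 + w) powr p"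
    by (rule mult_left_mono) simp
  also have "\<dots> = norm (a * (1 + w)) powr p"
    by (simp add: norm_mult powr_mult)
  also have "a * (1 + w) = a + b"
    using False by (simp add: w_def algebra_simps)
  moreover have "inner 1 (duality p a * b) = norm a powr p * x"
    by (simp add: inner_one_duality x_def w_def)
  ultimately show ?thesis by (simp add: algebra_simps)
qed (use assms in \<open>simp add: duality_def\<close>)

text \<open>At \<open>a = 0\<close> the quotient is
  \<open>norm b powr p * (n + 1) powr (1 - p)\<close>, which tends to \<open>0\<close> because
  \<open>p > 1\<close>. Elsewhere the norm is differentiated through its square, a polynomial in the
  step length. Steps are taken along a sequence, as dominated convergence requires, and
  \<open>Suc n\<close> keeps the reciprocal step length at least \<open>1\<close>.\<close>

lemma norm_powr_directional_limit:
  fixes a b :: "'k::{real_normed_field, real_inner}"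
  assumes "1 < p"
  shows "(\<lambda>n. real (Suc n) * (norm (a + of_real (inverse (real (Suc n))) * b) powr p - norm a powr p))
    \<longlonglongrightarrow> p * inner 1 (duality p a * b)"
proof (cases "a = 0")
  case True
  have "(\<lambda>n. norm b powr p * real (Suc n) powr (1 - p)) \<longlonglongrightarrow> norm b powr p * 0"
    using assms by (intro tendsto_mult tendsto_const tendsto_neg_powr
        filterlim_compose[OF filterlim_real_sequentially filterlim_Suc]) auto
  moreover have "real (Suc n) * norm (of_real (inverse (real (Suc n))) * b) powr p
      = norm b powr p * real (Suc n) powr (1 - p)" for n
  proof -
    have "norm (of_real (inverse (real (Suc n))) * b) powr p = real (Suc n) powr - p * norm b powr p"
      unfolding norm_mult norm_of_real by (simp add: powr_mult powr_minus inverse_powr)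
    moreover have "real (Suc n) powr (1 - p) = real (Suc n) * real (Suc n) powr - p"
      unfolding diff_conv_add_uminus powr_add by simp
    ultimately show ?thesis by simp
  qed
  ultimately show ?thesis
    using True by (simp add: duality_def)
next
  case False
  define w where "w = b / a"
  define x where "x = inner 1 w"
  \<comment> \<open>The square of \<open>norm (1 + t w)\<close>. Its value at \<open>0\<close> is
    \<open>1\<close> and its derivative there is \<open>2 * x\<close>, so its power
    \<open>p / 2\<close> has derivative \<open>p * x\<close>.\<close>
  define q where "q t = 1 + 2 * t * x + t\<^sup>2 * (norm w)\<^sup>2" for t :: real
  have nq: "norm (1 + of_real t * w) powr p = q t powr (p / 2)" for t
  proof -
    have "(norm (1 + of_real t * w))\<^sup>2 = q t"
      unfolding power2_norm_eq_inner q_def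
      by (simp add: inner_add_left inner_add_right x_def inner_commute power2_eq_square
          flip: scaleR_conv_of_real) (simp add: inner_commute flip: power2_norm_eq_inner)
    then have "q t powr (p / 2) = (norm (1 + of_real t * w) powr 2) powr (p / 2)"
      by simp
    then show ?thesis by (simp only: powr_powr) simp
  qed
  have "((\<lambda>t. q t powr (p / 2)) has_real_derivative p * x) (at 0)"
    unfolding q_def by (auto intro!: derivative_eq_intros)
  then have lim: "((\<lambda>t. (q t powr (p / 2) - 1) / t) \<longlongrightarrow> p * x) (at 0)"
    by (simp add: has_field_derivative_iff q_def)
  have "filterlim (\<lambda>n. inverse (real (Suc n))) (at 0) sequentially"
    unfolding filterlim_at using LIMSEQ_inverse_real_of_nat by auto
  from tendsto_mult[OF tendsto_const[of "norm a powr p"] filterlim_compose[OF lim this]]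
  have "(\<lambda>n. norm a powr p * ((q (inverse (real (Suc n))) powr (p / 2) - 1) / inverse (real (Suc n))))
      \<longlonglongrightarrow> norm a powr p * (p * x)" .
  moreover have "norm a powr p * ((q t powr (p / 2) - 1) / t) =
      inverse t * (norm (a + of_real t * b) powr p - norm a powr p)" for t
  proof -
    have "a + of_real t * b = a * (1 + of_real t * w)"
      using False by (simp add: w_def algebra_simps)
    then have "norm (a + of_real t * b) powr p = norm a powr p * q t powr (p / 2)"
      by (simp only: norm_mult powr_mult norm_ge_zero nq)
    then show ?thesis
      by (simp only:) (simp add: field_simps)
  qed
  moreover have "inner 1 (duality p a * b) = norm a powr p * x"
    by (simp add: inner_one_duality x_def w_def)
  ultimately show ?thesis by (simp add: mult.left_commute)
qed


text \<open>\<open>I\<close> acts as a gradient. If it is nonzero, the direction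
  \<open>\<alpha> = - inverse I\<close> makes \<open>\<alpha> * I = -1\<close>, and the one-sided
  derivative along it is negative, against minimality. If it is zero, the subgradient inequality is
  minimality itself. An abstract \<open>h\<close> serves the single and the iterated integral
  alike.\<close>

lemma minimal_iff_derivative_zero:
  fixes h :: "'k::{real_normed_field, real_inner} \<Rightarrow> real"
  assumes "0 < p"
    and sub: "\<And>\<alpha>. h 0 + p * inner 1 (\<alpha> * I) \<le> h \<alpha>"
    and lim: "\<And>\<alpha>. (\<lambda>n. real (Suc n) * (h (of_real (inverse (real (Suc n))) * \<alpha>) - h 0))
      \<longlonglongrightarrow> p * inner 1 (\<alpha> * I)"
  shows "(\<forall>\<alpha>. h 0 \<le> h \<alpha>) \<longleftrightarrow> I = 0"
proof
  assume min: "\<forall>\<alpha>. h 0 \<le> h \<alpha>"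
  have "0 \<le> p * inner 1 (- inverse I * I)"
    using min by (intro LIMSEQ_le_const[OF lim]) (auto intro!: mult_nonneg_nonneg)
  then show "I = 0"
    using \<open>0 < p\<close> by (cases "I = 0") (auto simp: zero_le_mult_iff simp flip: power2_norm_eq_inner)
qed (use sub in fastforce)

text \<open>Dominated convergence with majorant \<open>|L| + |U|\<close>, in the shape that fits
  convex difference quotients: \<open>L\<close> is the derivative and \<open>U\<close> the increment
  over the full step.\<close>

lemma integral_tendsto_between:
  fixes \<phi> :: "nat \<Rightarrow> 'a \<Rightarrow> real"
  assumes L: "integrable M L" and U: "integrable M U"
    and meas: "\<And>n. \<phi> n \<in> borel_measurable M" "D \<in> borel_measurable M"
    and bounds: "\<And>n s. s \<in> space M \<Longrightarrow> L s \<le> \<phi> n s" "\<And>n s. s \<in> space M \<Longrightarrow> \<phi> n s \<le> U s"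
    and lim: "\<And>s. s \<in> space M \<Longrightarrow> (\<lambda>n. \<phi> n s) \<longlonglongrightarrow> D s"
  shows "(\<lambda>n. \<integral>s. \<phi> n s \<partial>M) \<longlonglongrightarrow> (\<integral>s. D s \<partial>M)"
proof (rule integral_dominated_convergence[where w = "\<lambda>s. \<bar>L s\<bar> + \<bar>U s\<bar>"])
  show "AE s in M. norm (\<phi> n s) \<le> \<bar>L s\<bar> + \<bar>U s\<bar>" for n
  proof (rule AE_I2)
    fix s assume "s \<in> space M"
    then show "norm (\<phi> n s) \<le> \<bar>L s\<bar> + \<bar>U s\<bar>"
      using bounds[of s n] by auto
  qed
qed (use assms in auto)

section \<open>Scalar functions with integrable p-th power and derivatives of their
  integrals\<close>

definition Lp_fun :: "real \<Rightarrow> 'a measure \<Rightarrow> ('a \<Rightarrow> 'k::real_normed_vector) \<Rightarrow> bool" where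
  "Lp_fun p M f \<longleftrightarrow> f \<in> borel_measurable M \<and> integrable M (\<lambda>s. norm (f s) powr p)"

lemma Lp_fun_measurable: "Lp_fun p M f \<Longrightarrow> f \<in> borel_measurable M"
  and Lp_fun_integrable: "Lp_fun p M f \<Longrightarrow> integrable M (\<lambda>s. norm (f s) powr p)"
  by (simp_all add: Lp_fun_def)

lemma Lp_fun_zero: "Lp_fun p M (\<lambda>_. 0)"
  by (simp add: Lp_fun_def)

lemma Lp_fun_mult:
  fixes f :: "'a \<Rightarrow> 'k::{real_normed_field, euclidean_space}"
  assumes "Lp_fun p M f"
  shows "Lp_fun p M (\<lambda>s. c * f s)"
  using assms by (auto simp: Lp_fun_def norm_mult powr_mult)

lemma integrable_norm_add_powr:
  fixes f g :: "'a \<Rightarrow> 'k::euclidean_space"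
  assumes "0 \<le> p" "Lp_fun p M f" "Lp_fun p M g"
  shows "integrable M (\<lambda>s. (norm (f s) + norm (g s)) powr p)"
  using assms by (intro integrable_add_powr) (auto simp: Lp_fun_def)

lemma Lp_fun_add:
  fixes f g :: "'a \<Rightarrow> 'k::euclidean_space"
  assumes "0 \<le> p" "Lp_fun p M f" "Lp_fun p M g"
  shows "Lp_fun p M (\<lambda>s. f s + g s)"
  unfolding Lp_fun_def
proof
  have [measurable]: "f \<in> borel_measurable M" "g \<in> borel_measurable M"
    using assms by (auto simp: Lp_fun_def)
  show "(\<lambda>s. f s + g s) \<in> borel_measurable M"
    by measurable
  show "integrable M (\<lambda>s. norm (f s + g s) powr p)"
    using assms by (intro Bochner_Integration.integrable_bound[OF integrable_norm_add_powr[OF assms]])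
      (auto intro!: powr_mono2 norm_triangle_ineq)
qed

lemma integrable_duality:
  fixes f g :: "'a \<Rightarrow> 'k::{real_normed_field, euclidean_space}"
  assumes "1 \<le> p" "Lp_fun p M f" "Lp_fun p M g"
  shows "integrable M (\<lambda>s. duality p (f s) * g s)"
proof (rule Bochner_Integration.integrable_bound)
  show "integrable M (\<lambda>s. (norm (f s) + norm (g s)) powr p)"
    using assms by (intro integrable_norm_add_powr) auto
  have [measurable]: "f \<in> borel_measurable M" "g \<in> borel_measurable M"
    using assms by (auto simp: Lp_fun_def)
  show "(\<lambda>s. duality p (f s) * g s) \<in> borel_measurable M"
    by measurable
qed (use norm_duality_le[OF assms(1)] in auto)

lemma Lp_subgradient:
  fixes f g :: "'a \<Rightarrow> 'k::{real_normed_field, euclidean_space}"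
  assumes "1 \<le> p" "Lp_fun p M f" "Lp_fun p M g"
  shows "(\<integral>s. norm (f s) powr p \<partial>M) + p * inner 1 (\<integral>s. duality p (f s) * g s \<partial>M)
    \<le> (\<integral>s. norm (f s + g s) powr p \<partial>M)"
proof -
  note int = Lp_fun_integrable[OF assms(2)] integrable_duality[OF assms]
  have "(\<integral>s. norm (f s) powr p \<partial>M) + p * inner 1 (\<integral>s. duality p (f s) * g s \<partial>M)
      = (\<integral>s. norm (f s) powr p + p * inner 1 (duality p (f s) * g s) \<partial>M)"
    using int by simp
  also have "\<dots> \<le> (\<integral>s. norm (f s + g s) powr p \<partial>M)"
    using int assms
    by (intro integral_mono norm_powr_subgradient Lp_fun_integrable Lp_fun_add) auto
  finally show ?thesis .
qed

text \<open>Slopes of a convex function do not increase when the step shrinks from \<open>1\<close>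
  to \<open>1 / r\<close>; the factor \<open>r\<close> is the reciprocal step length.\<close>

lemma mult_norm_powr_diff_le:
  fixes a b :: "'k::real_normed_field"
  assumes "1 \<le> p" "1 \<le> r"
  shows "r * (norm (a + of_real (inverse r) * b) powr p - norm a powr p)
    \<le> norm (a + b) powr p - norm a powr p"
proof -
  have "norm (a + of_real (inverse r) * b) powr p - norm a powr p
      \<le> inverse r * (norm (a + b) powr p - norm a powr p)"
    using convex_norm_powr[OF assms(1), of "inverse r" a b] assms(2) by (simp add: inverse_le_1_iff)
  then have "r * (norm (a + of_real (inverse r) * b) powr p - norm a powr p)
      \<le> r * (inverse r * (norm (a + b) powr p - norm a powr p))"
    using assms by (intro mult_left_mono) auto
  also have "\<dots> = norm (a + b) powr p - norm a powr p"
    using assms by simp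
  finally show ?thesis .
qed

text \<open>The subgradient inequality for the increment \<open>b / r\<close>. Its linear term is
  real-linear in the increment, so multiplication by \<open>r\<close> restores the term belonging to
  \<open>b\<close>.\<close>

lemma mult_norm_powr_diff_ge:
  fixes a b :: "'k::{real_normed_field, real_inner}"
  assumes "1 \<le> p" "1 \<le> r"
  shows "p * inner 1 (duality p a * b)
    \<le> r * (norm (a + of_real (inverse r) * b) powr p - norm a powr p)"
proof -
  have *: "duality p a * (of_real (inverse r) * b) = inverse r *\<^sub>R (duality p a * b)"
    by (simp add: scaleR_conv_of_real)
  have "p * inner 1 (duality p a * b) = r * (inverse r * (p * inner 1 (duality p a * b)))"
    using assms by simp
  also from * have "\<dots> \<le> r * (norm (a + of_real (inverse r) * b) powr p - norm a powr p)"
    using norm_powr_subgradient[OF assms(1), of a "of_real (inverse r) * b"] assms(2)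
    by (intro mult_left_mono) (auto simp: mult.left_commute)
  finally show ?thesis .
qed

lemma Lp_directional_limit:
  fixes f g :: "'a \<Rightarrow> 'k::{real_normed_field, euclidean_space}"
  assumes "1 < p" "Lp_fun p M f" "Lp_fun p M g"
  shows "(\<lambda>n. real (Suc n) * ((\<integral>s. norm (f s + of_real (inverse (real (Suc n))) * g s) powr p \<partial>M)
      - (\<integral>s. norm (f s) powr p \<partial>M))) \<longlonglongrightarrow> p * inner 1 (\<integral>s. duality p (f s) * g s \<partial>M)"
proof -
  have p: "1 \<le> p" "0 \<le> p" using assms(1) by auto
  define \<phi> where "\<phi> n s =
      real (Suc n) * (norm (f s + of_real (inverse (real (Suc n))) * g s) powr p - norm (f s) powr p)" for n s
  have [measurable]: "f \<in> borel_measurable M" "g \<in> borel_measurable M"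
    using assms by (auto simp: Lp_fun_def)
  note D = integrable_duality[OF p(1) assms(2,3)]
  have sum: "Lp_fun p M (\<lambda>s. f s + c * g s)" for c
    using assms p by (intro Lp_fun_add Lp_fun_mult) auto
  have "(\<lambda>n. \<integral>s. \<phi> n s \<partial>M) \<longlonglongrightarrow> (\<integral>s. p * inner 1 (duality p (f s) * g s) \<partial>M)"
  proof (rule integral_tendsto_between)
    show "integrable M (\<lambda>s. p * inner 1 (duality p (f s) * g s))"
      using D by simp
    show "integrable M (\<lambda>s. norm (f s + g s) powr p - norm (f s) powr p)"
      using assms p sum[of 1] by (auto simp: Lp_fun_def)
    show "\<phi> n \<in> borel_measurable M" for n
      unfolding \<phi>_def[abs_def] by measurable
    show "(\<lambda>n. \<phi> n s) \<longlonglongrightarrow> p * inner 1 (duality p (f s) * g s)" for s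
      unfolding \<phi>_def using assms(1) by (rule norm_powr_directional_limit)
    show "p * inner 1 (duality p (f s) * g s) \<le> \<phi> n s" for n s
      unfolding \<phi>_def using p by (intro mult_norm_powr_diff_ge) auto
    show "\<phi> n s \<le> norm (f s + g s) powr p - norm (f s) powr p" for n s
      unfolding \<phi>_def using p by (intro mult_norm_powr_diff_le) auto
  qed measurable
  moreover have "(\<integral>s. \<phi> n s \<partial>M) =
      real (Suc n) * ((\<integral>s. norm (f s + of_real (inverse (real (Suc n))) * g s) powr p \<partial>M)
      - (\<integral>s. norm (f s) powr p \<partial>M))" for n
    using Lp_fun_integrable[OF sum] Lp_fun_integrable[OF assms(2)] by (simp add: \<phi>_def del: of_nat_Suc)
  ultimately show ?thesis
    using D by simp
qed

lemma Lp_minimal_iff: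
  fixes f g :: "'a \<Rightarrow> 'k::{real_normed_field, euclidean_space}"
  assumes "1 < p" "Lp_fun p M f" "Lp_fun p M g"
  shows "(\<forall>\<alpha>. (\<integral>s. norm (f s) powr p \<partial>M) \<le> (\<integral>s. norm (f s + \<alpha> * g s) powr p \<partial>M))
    \<longleftrightarrow> (\<integral>s. duality p (f s) * g s \<partial>M) = 0"
proof -
  have I: "(\<integral>s. duality p (f s) * (\<alpha> * g s) \<partial>M) = \<alpha> * (\<integral>s. duality p (f s) * g s \<partial>M)" for \<alpha>
  proof -
    have "(\<integral>s. duality p (f s) * (\<alpha> * g s) \<partial>M) = (\<integral>s. \<alpha> * (duality p (f s) * g s) \<partial>M)"
      by (simp add: mult.left_commute)
    then show ?thesis by simp
  qed
  \<comment> \<open>The term \<open>0 * g s\<close> displays the left side as the value at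
    \<open>0\<close> of the function on the right, the form that
    \<open>minimal_iff_derivative_zero\<close> expects.\<close>
  have "(\<forall>\<alpha>. (\<integral>s. norm (f s + 0 * g s) powr p \<partial>M) \<le> (\<integral>s. norm (f s + \<alpha> * g s) powr p \<partial>M))
    \<longleftrightarrow> (\<integral>s. duality p (f s) * g s \<partial>M) = 0"
  proof (rule minimal_iff_derivative_zero)
    show "(\<integral>s. norm (f s + 0 * g s) powr p \<partial>M) + p * inner 1 (\<alpha> * (\<integral>s. duality p (f s) * g s \<partial>M))
        \<le> (\<integral>s. norm (f s + \<alpha> * g s) powr p \<partial>M)" for \<alpha>
      using Lp_subgradient[of p M f "\<lambda>s. \<alpha> * g s"] assms by (simp add: I Lp_fun_mult)
    show "(\<lambda>n. real (Suc n) * ((\<integral>s. norm (f s + of_real (inverse (real (Suc n))) * \<alpha> * g s) powr p \<partial>M)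
          - (\<integral>s. norm (f s + 0 * g s) powr p \<partial>M)))
        \<longlonglongrightarrow> p * inner 1 (\<alpha> * (\<integral>s. duality p (f s) * g s \<partial>M))" for \<alpha>
      using Lp_directional_limit[of p M f "\<lambda>s. \<alpha> * g s"] assms
      by (simp add: I Lp_fun_mult mult.assoc del: of_nat_Suc)
  qed (use assms in auto)
  then show ?thesis by simp
qed

text \<open>For fixed \<open>s\<close> the inner integral is a convex function of
  \<open>\<alpha>\<close>; multiplicativity of \<open>duality\<close> makes its gradient at
  \<open>0\<close> equal to \<open>duality p (f1 s) * g1 s\<close> times the constant
  \<open>I2\<close>. Integration over \<open>M\<close> turns this into \<open>I1 * I2\<close>, and a
  product in a field vanishes iff a factor does. Hypothesis \<open>int\<close> carries all that is
  required of the dependence on \<open>s\<close>.\<close>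

lemma Lp_tensor_minimal_iff:
  fixes f1 g1 :: "'a \<Rightarrow> 'k::{real_normed_field, euclidean_space}" and f2 g2 :: "'b \<Rightarrow> 'k"
  assumes "1 < p" and L: "Lp_fun p M f1" "Lp_fun p M g1" "Lp_fun p N f2" "Lp_fun p N g2"
    and int: "\<And>\<alpha>. integrable M (\<lambda>s. \<integral>t. norm (f1 s * f2 t + \<alpha> * (g1 s * g2 t)) powr p \<partial>N)"
  shows "(\<forall>\<alpha>. (\<integral>s. \<integral>t. norm (f1 s * f2 t) powr p \<partial>N \<partial>M)
        \<le> (\<integral>s. \<integral>t. norm (f1 s * f2 t + \<alpha> * (g1 s * g2 t)) powr p \<partial>N \<partial>M))
    \<longleftrightarrow> (\<integral>s. duality p (f1 s) * g1 s \<partial>M) = 0 \<or> (\<integral>t. duality p (f2 t) * g2 t \<partial>N) = 0"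
proof -
  have p: "1 \<le> p" "0 \<le> p" using assms(1) by auto
  define \<Phi> where "\<Phi> s \<alpha> = (\<integral>t. norm (f1 s * f2 t + \<alpha> * (g1 s * g2 t)) powr p \<partial>N)" for s \<alpha>
  define I1 where "I1 = (\<integral>s. duality p (f1 s) * g1 s \<partial>M)"
  define I2 where "I2 = (\<integral>t. duality p (f2 t) * g2 t \<partial>N)"
  have int\<Phi>: "integrable M (\<lambda>s. \<Phi> s \<alpha>)" for \<alpha>
    using int by (simp add: \<Phi>_def)
  have I1: "integrable M (\<lambda>s. duality p (f1 s) * g1 s)"
    using p L by (intro integrable_duality) auto
  have D: "(\<integral>t. duality p (f1 s * f2 t) * (\<alpha> * (g1 s * g2 t)) \<partial>N) = \<alpha> * (duality p (f1 s) * g1 s) * I2" for s \<alpha>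
  proof -
    have "(\<integral>t. duality p (f1 s * f2 t) * (\<alpha> * (g1 s * g2 t)) \<partial>N)
        = (\<integral>t. (\<alpha> * (duality p (f1 s) * g1 s)) * (duality p (f2 t) * g2 t) \<partial>N)"
      by (simp add: duality_mult mult_ac)
    then show ?thesis by (simp add: I2_def)
  qed
  have DI: "integrable M (\<lambda>s. \<alpha> * (duality p (f1 s) * g1 s) * I2)"
    "(\<integral>s. \<alpha> * (duality p (f1 s) * g1 s) * I2 \<partial>M) = \<alpha> * (I1 * I2)" for \<alpha>
    using I1 by (simp_all add: I1_def)
  have sub: "\<Phi> s 0 + p * inner 1 (\<alpha> * (duality p (f1 s) * g1 s) * I2) \<le> \<Phi> s \<alpha>" for s \<alpha>
    using Lp_subgradient[of p N "\<lambda>t. f1 s * f2 t" "\<lambda>t. \<alpha> * (g1 s * g2 t)"] p L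
    by (simp add: \<Phi>_def D Lp_fun_mult)
  have lim: "(\<lambda>n. real (Suc n) * (\<Phi> s (of_real (inverse (real (Suc n))) * \<alpha>) - \<Phi> s 0))
      \<longlonglongrightarrow> p * inner 1 (\<alpha> * (duality p (f1 s) * g1 s) * I2)" for s \<alpha>
    using Lp_directional_limit[of p N "\<lambda>t. f1 s * f2 t" "\<lambda>t. \<alpha> * (g1 s * g2 t)"] assms(1) L
    by (simp add: \<Phi>_def D Lp_fun_mult mult.assoc del: of_nat_Suc)
  \<comment> \<open>Monotonicity of slopes, integrated over \<open>N\<close>.\<close>
  have upper: "real (Suc n) * (\<Phi> s (of_real (inverse (real (Suc n))) * \<alpha>) - \<Phi> s 0) \<le> \<Phi> s \<alpha> - \<Phi> s 0" for n s \<alpha>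
  proof -
    have i: "integrable N (\<lambda>t. norm (f1 s * f2 t + c * (g1 s * g2 t)) powr p)" for c
      using p L by (intro Lp_fun_integrable Lp_fun_add Lp_fun_mult) auto
    have "(\<integral>t. real (Suc n) * (norm (f1 s * f2 t + of_real (inverse (real (Suc n))) * (\<alpha> * (g1 s * g2 t))) powr p
        - norm (f1 s * f2 t) powr p) \<partial>N)
      \<le> (\<integral>t. norm (f1 s * f2 t + \<alpha> * (g1 s * g2 t)) powr p - norm (f1 s * f2 t) powr p \<partial>N)"
      using p i[of 0] i[of \<alpha>] i[of "of_real (inverse (real (Suc n))) * \<alpha>"]
      by (intro integral_mono mult_norm_powr_diff_le) (auto simp: mult.assoc simp del: of_nat_Suc)
    then show ?thesis
      using i[of 0] i[of \<alpha>] i[of "of_real (inverse (real (Suc n))) * \<alpha>"]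
      by (simp add: \<Phi>_def mult.assoc del: of_nat_Suc)
  qed
  \<comment> \<open>This is \<open>sub\<close> at the shrunken parameter: \<open>inner 1\<close> is
    real-linear, so the step length comes out and cancels against \<open>Suc n\<close>.\<close>
  have lower: "p * inner 1 (\<alpha> * (duality p (f1 s) * g1 s) * I2)
      \<le> real (Suc n) * (\<Phi> s (of_real (inverse (real (Suc n))) * \<alpha>) - \<Phi> s 0)" for n s \<alpha>
  proof -
    have "of_real (inverse (real (Suc n))) * \<alpha> * (duality p (f1 s) * g1 s) * I2
        = inverse (real (Suc n)) *\<^sub>R (\<alpha> * (duality p (f1 s) * g1 s) * I2)"
      by (simp add: scaleR_conv_of_real mult.assoc)
    then have "inner 1 (of_real (inverse (real (Suc n))) * \<alpha> * (duality p (f1 s) * g1 s) * I2)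
        = inverse (real (Suc n)) * inner 1 (\<alpha> * (duality p (f1 s) * g1 s) * I2)"
      by (simp only: inner_scaleR_right)
    then have "inverse (real (Suc n)) * (p * inner 1 (\<alpha> * (duality p (f1 s) * g1 s) * I2))
        \<le> \<Phi> s (of_real (inverse (real (Suc n))) * \<alpha>) - \<Phi> s 0"
      using sub[of s "of_real (inverse (real (Suc n))) * \<alpha>"] by (simp only:) (simp add: mult.left_commute)
    then have "real (Suc n) * (inverse (real (Suc n)) * (p * inner 1 (\<alpha> * (duality p (f1 s) * g1 s) * I2)))
        \<le> real (Suc n) * (\<Phi> s (of_real (inverse (real (Suc n))) * \<alpha>) - \<Phi> s 0)"
      by (intro mult_left_mono) auto
    then show ?thesis
      by (simp only: mult.assoc[symmetric] right_inverse of_nat_eq_0_iff nat.distinct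
          not_False_eq_True mult_1_left)
  qed
  have "(\<forall>\<alpha>. (\<integral>s. \<Phi> s 0 \<partial>M) \<le> (\<integral>s. \<Phi> s \<alpha> \<partial>M)) \<longleftrightarrow> I1 * I2 = 0"
  proof (rule minimal_iff_derivative_zero)
    fix \<alpha>
    have i: "integrable M (\<lambda>s. \<Phi> s 0)" "integrable M (\<lambda>s. p * inner 1 (\<alpha> * (duality p (f1 s) * g1 s) * I2))"
      using int\<Phi> DI by auto
    have e: "(\<integral>s. p * inner 1 (\<alpha> * (duality p (f1 s) * g1 s) * I2) \<partial>M) = p * inner 1 (\<alpha> * (I1 * I2))"
      using DI(1)[of \<alpha>] by (simp only: flip: DI(2)) (simp only: integral_mult_right_zero integral_inner_right)
    show "(\<integral>s. \<Phi> s 0 \<partial>M) + p * inner 1 (\<alpha> * (I1 * I2)) \<le> (\<integral>s. \<Phi> s \<alpha> \<partial>M)"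
      unfolding e[symmetric] Bochner_Integration.integral_add[OF i, symmetric]
      by (rule integral_mono[OF Bochner_Integration.integrable_add[OF i] int\<Phi> sub])
    \<comment> \<open>Dominated convergence in the outer variable. By \<open>lower\<close> and
      \<open>upper\<close> the quotients lie between the derivative and the full increment of
      \<open>\<Phi> s\<close>, both integrable over \<open>M\<close>.\<close>
    have "(\<lambda>n. \<integral>s. real (Suc n) * (\<Phi> s (of_real (inverse (real (Suc n))) * \<alpha>) - \<Phi> s 0) \<partial>M)
        \<longlonglongrightarrow> (\<integral>s. p * inner 1 (\<alpha> * (duality p (f1 s) * g1 s) * I2) \<partial>M)"
      by (rule integral_tendsto_between[OF i(2) Bochner_Integration.integrable_diff[OF int\<Phi>[of \<alpha>] i(1)]])
        (use i int\<Phi> lower upper lim in \<open>auto simp del: of_nat_Suc intro!: borel_measurable_integrable\<close>)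
    then show "(\<lambda>n. real (Suc n) * ((\<integral>s. \<Phi> s (of_real (inverse (real (Suc n))) * \<alpha>) \<partial>M) - (\<integral>s. \<Phi> s 0 \<partial>M)))
        \<longlonglongrightarrow> p * inner 1 (\<alpha> * (I1 * I2))"
      unfolding e using int\<Phi> by (simp del: of_nat_Suc)
  qed (use assms(1) in auto)
  then show ?thesis
    by (simp add: \<Phi>_def I1_def I2_def)
qed


section \<open>Vector spaces and seminormed spaces, and their quotients\<close>

locale vspace =
  fixes V :: "('k::field, 'v, 'm) vect_space_scheme"
  assumes zero_closed: "vzero V \<in> carrier V"
    and add_closed: "\<lbrakk>x \<in> carrier V; y \<in> carrier V\<rbrakk> \<Longrightarrow> vadd V x y \<in> carrier V"
    and scale_closed: "x \<in> carrier V \<Longrightarrow> vscale V a x \<in> carrier V"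
    and add_assoc: "\<lbrakk>x \<in> carrier V; y \<in> carrier V; z \<in> carrier V\<rbrakk> \<Longrightarrow>
      vadd V (vadd V x y) z = vadd V x (vadd V y z)"
    and add_commute: "\<lbrakk>x \<in> carrier V; y \<in> carrier V\<rbrakk> \<Longrightarrow> vadd V x y = vadd V y x"
    and add_zero: "x \<in> carrier V \<Longrightarrow> vadd V x (vzero V) = x"
    and add_inverse: "x \<in> carrier V \<Longrightarrow> vadd V x (vscale V (-1) x) = vzero V"
    and scale_add: "\<lbrakk>x \<in> carrier V; y \<in> carrier V\<rbrakk> \<Longrightarrow>
      vscale V a (vadd V x y) = vadd V (vscale V a x) (vscale V a y)"
    and add_scale: "x \<in> carrier V \<Longrightarrow> vscale V (a + b) x = vadd V (vscale V a x) (vscale V b x)"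
    and scale_scale: "x \<in> carrier V \<Longrightarrow> vscale V a (vscale V b x) = vscale V (a * b) x"
    and scale_one: "x \<in> carrier V \<Longrightarrow> vscale V 1 x = x"
begin

lemmas closed = zero_closed add_closed scale_closed

lemma sub_closed: "\<lbrakk>x \<in> carrier V; y \<in> carrier V\<rbrakk> \<Longrightarrow> vsub V x y \<in> carrier V"
  by (simp add: vsub_def closed)

lemma zero_add: "x \<in> carrier V \<Longrightarrow> vadd V (vzero V) x = x"
  by (simp add: add_commute[of "vzero V"] closed add_zero)

lemma add_left_commute:
  "\<lbrakk>x \<in> carrier V; y \<in> carrier V; z \<in> carrier V\<rbrakk> \<Longrightarrow>
    vadd V x (vadd V y z) = vadd V y (vadd V x z)"
  by (metis add_assoc add_commute)

text \<open>Uses \<open>0 = 1 + (-1)\<close>: the record has no negation, and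
  \<open>add_inverse\<close> speaks of the scalar \<open>-1\<close> instead.\<close>

lemma scale_zero_left:
  assumes "x \<in> carrier V"
  shows "vscale V 0 x = vzero V"
  using add_scale[OF assms, of 1 "-1"] assms by (simp add: scale_one add_inverse)

lemma scale_zero_right: "vscale V a (vzero V) = vzero V"
  using scale_scale[OF zero_closed, of a 0] by (simp add: scale_zero_left closed)

lemma sub_self: "x \<in> carrier V \<Longrightarrow> vsub V x x = vzero V"
  by (simp add: vsub_def add_inverse)

lemma sub_eq_zero_iff:
  assumes "x \<in> carrier V" "y \<in> carrier V"
  shows "vsub V x y = vzero V \<longleftrightarrow> x = y"
proof
  assume "vsub V x y = vzero V"
  then have "y = vadd V y (vadd V x (vscale V (-1) y))"
    using assms by (simp add: vsub_def add_zero)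
  also have "\<dots> = vadd V x (vadd V y (vscale V (-1) y))"
    using assms by (simp add: add_left_commute closed)
  finally show "x = y"
    using assms by (simp add: add_inverse add_zero)
qed (use assms in \<open>simp add: sub_self\<close>)

lemma sub_add_sub:
  assumes "x \<in> carrier V" "y \<in> carrier V" "z \<in> carrier V"
  shows "vadd V (vsub V x y) (vsub V y z) = vsub V x z"
proof -
  have "vadd V (vsub V x y) (vsub V y z) = vadd V x (vadd V (vadd V y (vscale V (-1) y)) (vscale V (-1) z))"
    using assms by (simp add: vsub_def closed add_assoc add_left_commute[of "vscale V (-1) y" y])
  then show ?thesis
    using assms by (simp add: vsub_def add_inverse zero_add closed)
qed

lemma scale_sub:
  assumes "x \<in> carrier V" "y \<in> carrier V"
  shows "vscale V a (vsub V x y) = vsub V (vscale V a x) (vscale V a y)"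
  using assms by (simp add: vsub_def scale_add scale_scale closed)

lemma minus_sub:
  assumes "x \<in> carrier V" "y \<in> carrier V"
  shows "vscale V (-1) (vsub V x y) = vsub V y x"
  using assms by (simp add: vsub_def scale_add scale_scale scale_one closed add_commute)

lemma add_sub_add:
  assumes "x \<in> carrier V" "y \<in> carrier V" "x' \<in> carrier V" "y' \<in> carrier V"
  shows "vsub V (vadd V x y) (vadd V x' y') = vadd V (vsub V x x') (vsub V y y')"
  using assms by (simp add: vsub_def scale_add closed add_assoc add_left_commute)

end

text \<open>
  The vector space laws are only required up to the equivalence that the quotient makes an equality:
  Bochner functions are unconstrained off the space of the measure, where they violate the laws.
\<close>

locale vspace_mod =
  fixes V :: "('k::field, 'v, 'm) vect_space_scheme" and N :: "'v set" and E :: "'v \<Rightarrow> 'v \<Rightarrow> bool"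
  assumes zero_closed: "vzero V \<in> carrier V"
    and add_closed: "\<lbrakk>x \<in> carrier V; y \<in> carrier V\<rbrakk> \<Longrightarrow> vadd V x y \<in> carrier V"
    and scale_closed: "x \<in> carrier V \<Longrightarrow> vscale V a x \<in> carrier V"
    and sub_iff: "\<lbrakk>x \<in> carrier V; y \<in> carrier V\<rbrakk> \<Longrightarrow> vsub V x y \<in> N \<longleftrightarrow> E x y"
    and refl: "x \<in> carrier V \<Longrightarrow> E x x"
    and sym: "\<lbrakk>x \<in> carrier V; y \<in> carrier V; E x y\<rbrakk> \<Longrightarrow> E y x"
    and trans: "\<lbrakk>x \<in> carrier V; y \<in> carrier V; z \<in> carrier V; E x y; E y z\<rbrakk> \<Longrightarrow> E x z"
    and cong_add: "\<lbrakk>x \<in> carrier V; x' \<in> carrier V; y \<in> carrier V; y' \<in> carrier V; E x x'; E y y'\<rbrakk> \<Longrightarrow>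
      E (vadd V x y) (vadd V x' y')"
    and cong_scale: "\<lbrakk>x \<in> carrier V; x' \<in> carrier V; E x x'\<rbrakk> \<Longrightarrow> E (vscale V a x) (vscale V a x')"
    and add_assoc: "\<lbrakk>x \<in> carrier V; y \<in> carrier V; z \<in> carrier V\<rbrakk> \<Longrightarrow>
      E (vadd V (vadd V x y) z) (vadd V x (vadd V y z))"
    and add_commute: "\<lbrakk>x \<in> carrier V; y \<in> carrier V\<rbrakk> \<Longrightarrow> E (vadd V x y) (vadd V y x)"
    and add_zero: "x \<in> carrier V \<Longrightarrow> E (vadd V x (vzero V)) x"
    and add_inverse: "x \<in> carrier V \<Longrightarrow> E (vadd V x (vscale V (-1) x)) (vzero V)"
    and scale_add: "\<lbrakk>x \<in> carrier V; y \<in> carrier V\<rbrakk> \<Longrightarrow>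
      E (vscale V a (vadd V x y)) (vadd V (vscale V a x) (vscale V a y))"
    and add_scale: "x \<in> carrier V \<Longrightarrow>
      E (vscale V (a + b) x) (vadd V (vscale V a x) (vscale V b x))"
    and scale_scale: "x \<in> carrier V \<Longrightarrow> E (vscale V a (vscale V b x)) (vscale V (a * b) x)"
    and scale_one: "x \<in> carrier V \<Longrightarrow> E (vscale V 1 x) x"
begin

lemmas closed = zero_closed add_closed scale_closed

lemma mem_coset_iff: "x \<in> carrier V \<Longrightarrow> y \<in> coset V N x \<longleftrightarrow> y \<in> carrier V \<and> E y x"
  by (auto simp: coset_def sub_iff)

lemma self_mem_coset: "x \<in> carrier V \<Longrightarrow> x \<in> coset V N x"
  by (simp add: mem_coset_iff refl)

lemma coset_eqI: "\<lbrakk>x \<in> carrier V; y \<in> carrier V; E x y\<rbrakk> \<Longrightarrow> coset V N x = coset V N y"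
  by (intro set_eqI) (metis mem_coset_iff sym trans)

text \<open>The quotient operations are unions over all representatives. Such a union collapses
  because every representative contributes the same set and the coset is nonempty.\<close>

lemma UN_coset_const:
  assumes "x \<in> carrier V" "\<And>y. \<lbrakk>y \<in> carrier V; E y x\<rbrakk> \<Longrightarrow> g y = g x"
  shows "(\<Union>y\<in>coset V N x. g y) = g x"
proof -
  have "g y = g x" if "y \<in> coset V N x" for y
    by (rule assms(2)) (use that mem_coset_iff[OF assms(1)] in auto)
  then have "g ` coset V N x = {g x}"
    using self_mem_coset[OF assms(1)] by blast
  then show ?thesis by simp
qed

lemma quot_add:
  assumes "x \<in> carrier V" "y \<in> carrier V"
  shows "vadd (quot_space V N) (coset V N x) (coset V N y) = coset V N (vadd V x y)"
proof -
  have "vadd (quot_space V N) (coset V N x) (coset V N y)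
      = (\<Union>a\<in>coset V N x. \<Union>b\<in>coset V N y. coset V N (vadd V a b))"
    by (simp add: quot_space_def)
  \<comment> \<open>The two unions are collapsed one at a time, the inner one for a fixed
    representative \<open>a\<close>.\<close>
  also have "\<dots> = (\<Union>a\<in>coset V N x. coset V N (vadd V a y))"
  proof (rule SUP_cong[OF HOL.refl])
    fix a assume "a \<in> coset V N x"
    then have a: "a \<in> carrier V"
      using assms by (simp add: mem_coset_iff)
    show "(\<Union>b\<in>coset V N y. coset V N (vadd V a b)) = coset V N (vadd V a y)"
      by (rule UN_coset_const[OF assms(2)], rule coset_eqI)
        (simp_all add: a assms closed refl cong_add)
  qed
  also have "\<dots> = coset V N (vadd V x y)"
    by (rule UN_coset_const[OF assms(1)], rule coset_eqI) (simp_all add: assms closed refl cong_add)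
  finally show ?thesis .
qed

lemma quot_scale:
  assumes "x \<in> carrier V"
  shows "vscale (quot_space V N) a (coset V N x) = coset V N (vscale V a x)"
proof -
  have "vscale (quot_space V N) a (coset V N x) = (\<Union>y\<in>coset V N x. coset V N (vscale V a y))"
    by (simp add: quot_space_def)
  also have "\<dots> = coset V N (vscale V a x)"
    by (rule UN_coset_const[OF assms], rule coset_eqI) (simp_all add: assms closed cong_scale)
  finally show ?thesis .
qed

lemma quot_zero: "vzero (quot_space V N) = coset V N (vzero V)"
  by (simp add: quot_space_def)

lemma quot_carrier: "carrier (quot_space V N) = coset V N ` carrier V"
  by (simp add: quot_space_def)

lemma vspace_quot: "vspace (quot_space V N)"
  by unfold_locales
    ((auto simp: quot_carrier quot_add quot_scale quot_zero closed; fail)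
      | (clarsimp simp: quot_carrier quot_add quot_scale quot_zero closed, rule coset_eqI;
         simp add: closed add_assoc add_commute add_zero add_inverse scale_add add_scale
           scale_scale scale_one))+

end

lemma vspace_with_norm_iff: "vspace (with_norm V n) \<longleftrightarrow> vspace V"
  by (simp add: vspace_def with_norm_def)

section \<open>Seminorms, on spaces and on their quotients\<close>

locale seminormed = vspace V for V :: "('k::real_normed_field, 'v) norm_space" +
  assumes norm_nonneg: "x \<in> carrier V \<Longrightarrow> 0 \<le> vnorm V x"
    and norm_scale: "x \<in> carrier V \<Longrightarrow> vnorm V (vscale V a x) = norm a * vnorm V x"
    and norm_triangle: "\<lbrakk>x \<in> carrier V; y \<in> carrier V\<rbrakk> \<Longrightarrow>
      vnorm V (vadd V x y) \<le> vnorm V x + vnorm V y"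
begin

lemma norm_zero: "vnorm V (vzero V) = 0"
  using norm_scale[OF zero_closed, of 0] by (simp add: scale_zero_left zero_closed)

lemma norm_sub_commute:
  "\<lbrakk>x \<in> carrier V; y \<in> carrier V\<rbrakk> \<Longrightarrow> vnorm V (vsub V x y) = vnorm V (vsub V y x)"
  using norm_scale[OF sub_closed, of y x "-1"] by (simp add: minus_sub)

lemma norm_sub_triangle:
  "\<lbrakk>x \<in> carrier V; y \<in> carrier V; z \<in> carrier V\<rbrakk> \<Longrightarrow>
    vnorm V (vsub V x z) \<le> vnorm V (vsub V x y) + vnorm V (vsub V y z)"
  using norm_triangle[OF sub_closed sub_closed, of x y y z] by (simp add: sub_add_sub)

lemma norm_add_sub_add:
  "\<lbrakk>x \<in> carrier V; y \<in> carrier V; x' \<in> carrier V; y' \<in> carrier V\<rbrakk> \<Longrightarrow>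
    vnorm V (vsub V (vadd V x y) (vadd V x' y')) \<le> vnorm V (vsub V x x') + vnorm V (vsub V y y')"
  using norm_triangle[OF sub_closed sub_closed, of x x' y y'] by (simp add: add_sub_add)

lemma norm_scale_sub_scale:
  "\<lbrakk>x \<in> carrier V; y \<in> carrier V\<rbrakk> \<Longrightarrow>
    vnorm V (vsub V (vscale V a x) (vscale V a y)) = norm a * vnorm V (vsub V x y)"
  using norm_scale[OF sub_closed, of x y a] by (simp add: scale_sub)

lemma norm_diff_le:
  assumes "x \<in> carrier V" "y \<in> carrier V"
  shows "\<bar>vnorm V x - vnorm V y\<bar> \<le> vnorm V (vsub V x y)"
proof -
  have *: "vnorm V x \<le> vnorm V (vsub V x y) + vnorm V y" if "x \<in> carrier V" "y \<in> carrier V" for x y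
  proof -
    have "vnorm V (vadd V (vsub V x y) y) \<le> vnorm V (vsub V x y) + vnorm V y"
      using that by (intro norm_triangle sub_closed)
    moreover have "vadd V (vsub V x y) y = x"
      using that by (simp add: vsub_def add_assoc closed add_commute[of "vscale V (-1) y"] add_inverse add_zero)
    ultimately show ?thesis by simp
  qed
  show ?thesis
    using *[OF assms] *[OF assms(2,1)] norm_sub_commute[OF assms] by linarith
qed

end

locale seminormed_mod = vspace_mod V N E
  for V :: "('k::real_normed_field, 'v) norm_space" and N :: "'v set" and E :: "'v \<Rightarrow> 'v \<Rightarrow> bool" +
  assumes norm_cong: "\<lbrakk>x \<in> carrier V; y \<in> carrier V; E x y\<rbrakk> \<Longrightarrow> vnorm V x = vnorm V y"
    and norm_nonneg: "x \<in> carrier V \<Longrightarrow> 0 \<le> vnorm V x"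
    and norm_scale: "x \<in> carrier V \<Longrightarrow> vnorm V (vscale V a x) = norm a * vnorm V x"
    and norm_triangle: "\<lbrakk>x \<in> carrier V; y \<in> carrier V\<rbrakk> \<Longrightarrow>
      vnorm V (vadd V x y) \<le> vnorm V x + vnorm V y"
begin

lemma norm_quot_simps:
  "carrier (norm_quot_space V N) = coset V N ` carrier V"
  "vzero (norm_quot_space V N) = coset V N (vzero V)"
  "\<lbrakk>x \<in> carrier V; y \<in> carrier V\<rbrakk> \<Longrightarrow>
    vadd (norm_quot_space V N) (coset V N x) (coset V N y) = coset V N (vadd V x y)"
  "x \<in> carrier V \<Longrightarrow> vscale (norm_quot_space V N) a (coset V N x) = coset V N (vscale V a x)"
  by (simp_all add: norm_quot_space_def with_norm_def quot_carrier quot_zero quot_add quot_scale)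

text \<open>By \<open>norm_cong\<close> the norm takes a single value on a coset, which is what
  gives \<open>the_elem\<close> its meaning.\<close>

lemma norm_quot:
  assumes "x \<in> carrier V"
  shows "vnorm (norm_quot_space V N) (coset V N x) = vnorm V x"
proof -
  have "vnorm V y = vnorm V x" if "y \<in> coset V N x" for y
    by (rule norm_cong) (use that assms in \<open>simp_all add: mem_coset_iff\<close>)
  then have "vnorm V ` coset V N x = {vnorm V x}"
    using self_mem_coset[OF assms] by blast
  then show ?thesis by (simp add: norm_quot_space_def with_norm_def)
qed

lemma seminormed_norm_quot: "seminormed (norm_quot_space V N)"
proof -
  have "vspace (norm_quot_space V N)"
    by (simp add: norm_quot_space_def vspace_with_norm_iff vspace_quot)
  moreover have "seminormed_axioms (norm_quot_space V N)"
  proof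
    fix A B and a :: 'k
    assume "A \<in> carrier (norm_quot_space V N)"
    then obtain x where x: "A = coset V N x" "x \<in> carrier V"
      by (auto simp: norm_quot_simps)
    show "0 \<le> vnorm (norm_quot_space V N) A"
      using x by (simp add: norm_quot norm_nonneg)
    show "vnorm (norm_quot_space V N) (vscale (norm_quot_space V N) a A)
        = norm a * vnorm (norm_quot_space V N) A"
      using x by (simp add: norm_quot_simps norm_quot closed norm_scale)
    assume "B \<in> carrier (norm_quot_space V N)"
    then obtain y where "B = coset V N y" "y \<in> carrier V"
      by (auto simp: norm_quot_simps)
    then show "vnorm (norm_quot_space V N) (vadd (norm_quot_space V N) A B)
        \<le> vnorm (norm_quot_space V N) A + vnorm (norm_quot_space V N) B"
      using x by (simp add: norm_quot_simps norm_quot closed norm_triangle)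
  qed
  ultimately show ?thesis
    by (rule seminormed.intro)
qed

lemma BJ_norm_quot_iff:
  assumes "x \<in> carrier V" "y \<in> carrier V"
  shows "BJ_orthogonal (norm_quot_space V N) (coset V N x) (coset V N y)
    \<longleftrightarrow> (\<forall>\<alpha>. vnorm V x \<le> vnorm V (vadd V x (vscale V \<alpha> y)))"
  using assms by (simp add: BJ_orthogonal_def norm_quot_simps norm_quot closed)

end

text \<open>Made for \<open>\<Delta>_p\<close>, which is the Bochner norm pulled back along the
  canonical map of the tensor product.\<close>

lemma seminormed_pullback:
  assumes "vspace V" "seminormed W" "is_linear V W h"
  shows "seminormed (with_norm V (\<lambda>u. vnorm W (h u)))"
proof -
  interpret V: vspace V by fact
  interpret W: seminormed W by fact
  have h: "\<And>x. x \<in> carrier V \<Longrightarrow> h x \<in> carrier W"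
    "\<And>x y. \<lbrakk>x \<in> carrier V; y \<in> carrier V\<rbrakk> \<Longrightarrow> h (vadd V x y) = vadd W (h x) (h y)"
    "\<And>x a. x \<in> carrier V \<Longrightarrow> h (vscale V a x) = vscale W a (h x)"
    using assms(3) by (auto simp: is_linear_def)
  have "vspace (with_norm V (\<lambda>u. vnorm W (h u)))"
    using assms(1) by (simp add: vspace_with_norm_iff)
  then show ?thesis
    by (rule seminormed.intro, unfold_locales)
      (auto simp: with_norm_def h V.closed W.norm_nonneg W.norm_scale W.norm_triangle)
qed

section \<open>Completion\<close>

context seminormed
begin

definition cauchy_seq :: "(nat \<Rightarrow> 'v) \<Rightarrow> bool" where
  "cauchy_seq \<sigma> \<longleftrightarrow> (\<forall>n. \<sigma> n \<in> carrier V) \<and>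
    (\<forall>e>0. \<exists>n0. \<forall>m\<ge>n0. \<forall>n\<ge>n0. vnorm V (vsub V (\<sigma> m) (\<sigma> n)) < e)"

lemma cauchy_seq_const: "x \<in> carrier V \<Longrightarrow> cauchy_seq (\<lambda>n. x)"
  by (simp add: cauchy_seq_def sub_self norm_zero)

lemma cauchy_seq_add:
  assumes "cauchy_seq \<sigma>" "cauchy_seq \<tau>"
  shows "cauchy_seq (\<lambda>n. vadd V (\<sigma> n) (\<tau> n))"
  unfolding cauchy_seq_def
proof (intro conjI allI impI)
  have C: "\<sigma> n \<in> carrier V" "\<tau> n \<in> carrier V" for n
    using assms by (auto simp: cauchy_seq_def)
  then show "vadd V (\<sigma> n) (\<tau> n) \<in> carrier V" for n
    by (simp add: closed)
  fix e :: real assume "0 < e"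
  then have "0 < e / 2" by simp
  with assms obtain n0 n1 where
    n0: "\<And>m n. \<lbrakk>n0 \<le> m; n0 \<le> n\<rbrakk> \<Longrightarrow> vnorm V (vsub V (\<sigma> m) (\<sigma> n)) < e / 2" and
    n1: "\<And>m n. \<lbrakk>n1 \<le> m; n1 \<le> n\<rbrakk> \<Longrightarrow> vnorm V (vsub V (\<tau> m) (\<tau> n)) < e / 2"
    unfolding cauchy_seq_def by meson
  have "vnorm V (vsub V (vadd V (\<sigma> m) (\<tau> m)) (vadd V (\<sigma> n) (\<tau> n))) < e"
    if "max n0 n1 \<le> m" "max n0 n1 \<le> n" for m n
    using norm_add_sub_add[of "\<sigma> m" "\<tau> m" "\<sigma> n" "\<tau> n"] n0[of m n] n1[of m n] that C by fastforce
  then show "\<exists>n0. \<forall>m\<ge>n0. \<forall>n\<ge>n0. vnorm V (vsub V (vadd V (\<sigma> m) (\<tau> m)) (vadd V (\<sigma> n) (\<tau> n))) < e"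
    by blast
qed

lemma cauchy_seq_scale:
  assumes "cauchy_seq \<sigma>"
  shows "cauchy_seq (\<lambda>n. vscale V a (\<sigma> n))"
  unfolding cauchy_seq_def
proof (intro conjI allI impI)
  have C: "\<sigma> n \<in> carrier V" for n
    using assms by (auto simp: cauchy_seq_def)
  then show "vscale V a (\<sigma> n) \<in> carrier V" for n
    by (simp add: closed)
  fix e :: real assume "0 < e"
  \<comment> \<open>The summand \<open>1\<close> keeps the denominator positive when
    \<open>a = 0\<close>.\<close>
  then have "0 < e / (norm a + 1)"
    by (intro divide_pos_pos add_nonneg_pos) auto
  with assms obtain n0 where
    n0: "\<And>m n. \<lbrakk>n0 \<le> m; n0 \<le> n\<rbrakk> \<Longrightarrow> vnorm V (vsub V (\<sigma> m) (\<sigma> n)) < e / (norm a + 1)"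
    unfolding cauchy_seq_def by meson
  have "vnorm V (vsub V (vscale V a (\<sigma> m)) (vscale V a (\<sigma> n))) < e" if "n0 \<le> m" "n0 \<le> n" for m n
  proof -
    have "norm a * vnorm V (vsub V (\<sigma> m) (\<sigma> n)) \<le> (norm a + 1) * vnorm V (vsub V (\<sigma> m) (\<sigma> n))"
      using C by (intro mult_right_mono norm_nonneg sub_closed) auto
    also have "\<dots> < (norm a + 1) * (e / (norm a + 1))"
      using n0[OF that] by (intro mult_strict_left_mono add_nonneg_pos) auto
    also have "\<dots> = e"
      using add_nonneg_pos[OF norm_ge_zero[of a] zero_less_one] by simp
    finally show ?thesis
      using C by (simp add: norm_scale_sub_scale)
  qed
  then show "\<exists>n0. \<forall>m\<ge>n0. \<forall>n\<ge>n0. vnorm V (vsub V (vscale V a (\<sigma> m)) (vscale V a (\<sigma> n))) < e"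
    by blast
qed

text \<open>By the reverse triangle inequality the norms form a Cauchy sequence of reals, so the
  \<open>lim\<close> in \<open>cauchy_space\<close> is a genuine limit rather than an unspecified
  value.\<close>

lemma cauchy_seq_norm_tendsto:
  assumes "cauchy_seq \<sigma>"
  shows "(\<lambda>n. vnorm V (\<sigma> n)) \<longlonglongrightarrow> lim (\<lambda>n. vnorm V (\<sigma> n))"
proof -
  have C: "\<sigma> n \<in> carrier V" for n
    using assms by (auto simp: cauchy_seq_def)
  have "Cauchy (\<lambda>n. vnorm V (\<sigma> n))"
  proof (rule metric_CauchyI)
    fix e :: real assume "0 < e"
    with assms obtain n0 where
      "\<And>m n. \<lbrakk>n0 \<le> m; n0 \<le> n\<rbrakk> \<Longrightarrow> vnorm V (vsub V (\<sigma> m) (\<sigma> n)) < e"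
      unfolding cauchy_seq_def by meson
    then show "\<exists>n0. \<forall>m\<ge>n0. \<forall>n\<ge>n0. dist (vnorm V (\<sigma> m)) (vnorm V (\<sigma> n)) < e"
      using norm_diff_le[OF C C] unfolding dist_real_def by (meson order.strict_trans1)
  qed
  then show ?thesis
    by (simp add: Cauchy_convergent_iff convergent_LIMSEQ_iff)
qed

lemma cauchy_space_simps:
  "carrier (cauchy_space V) = Collect cauchy_seq"
  "vadd (cauchy_space V) \<sigma> \<tau> = (\<lambda>n. vadd V (\<sigma> n) (\<tau> n))"
  "vzero (cauchy_space V) = (\<lambda>n. vzero V)"
  "vscale (cauchy_space V) a \<sigma> = (\<lambda>n. vscale V a (\<sigma> n))"
  "vnorm (cauchy_space V) \<sigma> = lim (\<lambda>n. vnorm V (\<sigma> n))"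
  "vsub (cauchy_space V) \<sigma> \<tau> = (\<lambda>n. vsub V (\<sigma> n) (\<tau> n))"
  by (auto simp: cauchy_space_def cauchy_seq_def vsub_def)

text \<open>The vector space laws hold index by index. The congruences and the limit norm follow by
  passing to the limit in the triangle inequalities of \<open>V\<close>, and equivalent sequences
  have the same limit norm by the reverse triangle inequality.\<close>

lemma seminormed_mod_cauchy_space:
  "seminormed_mod (cauchy_space V) (null_seqs V) (\<lambda>\<sigma> \<tau>. (\<lambda>n. vnorm V (vsub V (\<sigma> n) (\<tau> n))) \<longlonglongrightarrow> 0)"
proof -
  have C: "cauchy_seq \<sigma> \<Longrightarrow> \<sigma> n \<in> carrier V" for \<sigma> n
    by (simp add: cauchy_seq_def)
  note simps = cauchy_space_simps mem_Collect_eq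
  show ?thesis
  proof (unfold_locales; unfold simps)
    fix \<sigma> \<tau> assume \<sigma>: "cauchy_seq \<sigma>" and \<tau>: "cauchy_seq \<tau>"
    show "(\<lambda>n. vsub V (\<sigma> n) (\<tau> n)) \<in> null_seqs V \<longleftrightarrow> (\<lambda>n. vnorm V (vsub V (\<sigma> n) (\<tau> n))) \<longlonglongrightarrow> 0"
      using \<sigma> \<tau> by (simp add: null_seqs_def C sub_closed)
    show "(\<lambda>n. vnorm V (vsub V (\<tau> n) (\<sigma> n))) \<longlonglongrightarrow> 0" if "(\<lambda>n. vnorm V (vsub V (\<sigma> n) (\<tau> n))) \<longlonglongrightarrow> 0"
      using that \<sigma> \<tau> by (simp add: norm_sub_commute[of "\<tau> _"] C)
    show "lim (\<lambda>n. vnorm V (\<sigma> n)) = lim (\<lambda>n. vnorm V (\<tau> n))"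
      if "(\<lambda>n. vnorm V (vsub V (\<sigma> n) (\<tau> n))) \<longlonglongrightarrow> 0"
    proof -
      have "(\<lambda>n. vnorm V (\<sigma> n) - vnorm V (\<tau> n)) \<longlonglongrightarrow> 0"
        by (rule Lim_null_comparison[OF _ that]) (use \<sigma> \<tau> in \<open>simp add: norm_diff_le C\<close>)
      from tendsto_add[OF this cauchy_seq_norm_tendsto[OF \<tau>]]
      show ?thesis by (simp add: limI)
    qed
    show "lim (\<lambda>n. vnorm V (vadd V (\<sigma> n) (\<tau> n))) \<le> lim (\<lambda>n. vnorm V (\<sigma> n)) + lim (\<lambda>n. vnorm V (\<tau> n))"
      by (rule LIMSEQ_le[OF cauchy_seq_norm_tendsto[OF cauchy_seq_add[OF \<sigma> \<tau>]]
            tendsto_add[OF cauchy_seq_norm_tendsto[OF \<sigma>] cauchy_seq_norm_tendsto[OF \<tau>]]])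
        (use \<sigma> \<tau> in \<open>auto intro!: norm_triangle C\<close>)
    show "(\<lambda>n. vnorm V (vsub V (vscale V a (\<sigma> n)) (vscale V a (\<tau> n)))) \<longlonglongrightarrow> 0"
      if "(\<lambda>n. vnorm V (vsub V (\<sigma> n) (\<tau> n))) \<longlonglongrightarrow> 0" for a
      using tendsto_mult_right_zero[OF that, of "norm a"] \<sigma> \<tau> by (simp add: norm_scale_sub_scale C)
  next
    fix \<sigma> \<tau> \<rho> assume *: "cauchy_seq \<sigma>" "cauchy_seq \<tau>" "cauchy_seq \<rho>"
      "(\<lambda>n. vnorm V (vsub V (\<sigma> n) (\<tau> n))) \<longlonglongrightarrow> 0" "(\<lambda>n. vnorm V (vsub V (\<tau> n) (\<rho> n))) \<longlonglongrightarrow> 0"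
    show "(\<lambda>n. vnorm V (vsub V (\<sigma> n) (\<rho> n))) \<longlonglongrightarrow> 0"
      by (rule Lim_null_comparison[OF _ tendsto_add_zero[OF *(4,5)]])
        (use *(1-3) in \<open>simp add: norm_sub_triangle norm_nonneg sub_closed C\<close>)
  next
    fix \<sigma> \<sigma>' \<tau> \<tau>' assume *: "cauchy_seq \<sigma>" "cauchy_seq \<sigma>'" "cauchy_seq \<tau>" "cauchy_seq \<tau>'"
      "(\<lambda>n. vnorm V (vsub V (\<sigma> n) (\<sigma>' n))) \<longlonglongrightarrow> 0" "(\<lambda>n. vnorm V (vsub V (\<tau> n) (\<tau>' n))) \<longlonglongrightarrow> 0"
    show "(\<lambda>n. vnorm V (vsub V (vadd V (\<sigma> n) (\<tau> n)) (vadd V (\<sigma>' n) (\<tau>' n)))) \<longlonglongrightarrow> 0"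
      by (rule Lim_null_comparison[OF _ tendsto_add_zero[OF *(5,6)]])
        (use *(1-4) in \<open>simp add: norm_add_sub_add norm_nonneg sub_closed closed C\<close>)
  next
    fix \<sigma> and a :: 'k assume \<sigma>: "cauchy_seq \<sigma>"
    show "0 \<le> lim (\<lambda>n. vnorm V (\<sigma> n))"
      by (rule LIMSEQ_le_const[OF cauchy_seq_norm_tendsto[OF \<sigma>]]) (use \<sigma> in \<open>auto intro!: norm_nonneg C\<close>)
    show "lim (\<lambda>n. vnorm V (vscale V a (\<sigma> n))) = norm a * lim (\<lambda>n. vnorm V (\<sigma> n))"
      using tendsto_mult_left[OF cauchy_seq_norm_tendsto[OF \<sigma>], of "norm a"] \<sigma>
      by (intro limI) (simp add: norm_scale C)
  qed (simp_all add: cauchy_seq_const cauchy_seq_add cauchy_seq_scale closed C add_assoc add_commute add_left_commute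
      add_zero add_inverse scale_add add_scale scale_scale scale_one sub_self norm_zero)
qed

text \<open>Elements of \<open>V\<close> embed as classes of constant sequences, whose limit norm is
  the original norm, and \<open>x + \<alpha> y\<close> is again such an element. Orthogonality in
  the completion is therefore a condition inside \<open>V\<close>.\<close>

lemma BJ_completion_iff:
  assumes "x \<in> carrier V" "y \<in> carrier V"
  shows "BJ_orthogonal (norm_completion V) (to_completion V x) (to_completion V y)
    \<longleftrightarrow> (\<forall>\<alpha>. vnorm V x \<le> vnorm V (vadd V x (vscale V \<alpha> y)))"
proof -
  interpret C: seminormed_mod "cauchy_space V" "null_seqs V"
      "\<lambda>\<sigma> \<tau>. (\<lambda>n. vnorm V (vsub V (\<sigma> n) (\<tau> n))) \<longlonglongrightarrow> 0"
    by (rule seminormed_mod_cauchy_space)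
  have "(\<lambda>n. x) \<in> carrier (cauchy_space V)" "(\<lambda>n. y) \<in> carrier (cauchy_space V)"
    using assms by (simp_all add: cauchy_space_simps cauchy_seq_const)
  from C.BJ_norm_quot_iff[OF this] show ?thesis
    by (simp add: norm_completion_def to_completion_def cauchy_space_simps limI)
qed

end


section \<open>The universal property of the tensor product\<close>

context vspace
begin

text \<open>The guard makes the folded function commute also outside the carrier, as
  \<^locale>\<open>comp_fun_commute\<close> requires.\<close>

definition vsum :: "('b \<Rightarrow> 'v) \<Rightarrow> 'b set \<Rightarrow> 'v" where
  "vsum a A = Finite_Set.fold
     (\<lambda>b x. if a b \<in> carrier V \<and> x \<in> carrier V then vadd V (a b) x else x) (vzero V) A"

lemma vsum_empty [simp]: "vsum a {} = vzero V"
  by (simp add: vsum_def)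

text \<open>The guarded recursion makes no assumption on \<open>a\<close>, so induction with it
  shows that every sum lies in the carrier; only after that can half of the guard be
  discharged.\<close>

lemma vsum_insert_guarded:
  assumes "finite A" "b \<notin> A"
  shows "vsum a (insert b A) =
    (if a b \<in> carrier V \<and> vsum a A \<in> carrier V then vadd V (a b) (vsum a A) else vsum a A)"
proof -
  interpret comp_fun_commute "\<lambda>b x. if a b \<in> carrier V \<and> x \<in> carrier V then vadd V (a b) x else x"
    by standard (auto simp: fun_eq_iff closed add_left_commute)
  show ?thesis
    unfolding vsum_def using assms by (rule fold_insert)
qed

lemma vsum_closed: "vsum a A \<in> carrier V"
proof (cases "finite A")
  case True
  then show ?thesis
    by (induction A) (simp_all add: closed vsum_insert_guarded)
qed (simp add: vsum_def closed)

lemma vsum_insert: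
  assumes "finite A" "b \<notin> A" "a b \<in> carrier V"
  shows "vsum a (insert b A) = vadd V (a b) (vsum a A)"
  using assms by (simp add: vsum_insert_guarded vsum_closed)

lemma vsum_cong:
  assumes "\<And>b. b \<in> A \<Longrightarrow> a b = a' b"
  shows "vsum a A = vsum a' A"
proof (cases "finite A")
  case True
  then show ?thesis using assms
    by (induction A) (simp_all add: vsum_insert_guarded)
qed (simp add: vsum_def)

lemma vsum_add:
  assumes "finite A" "\<And>b. b \<in> A \<Longrightarrow> a b \<in> carrier V" "\<And>b. b \<in> A \<Longrightarrow> a' b \<in> carrier V"
  shows "vsum (\<lambda>b. vadd V (a b) (a' b)) A = vadd V (vsum a A) (vsum a' A)"
  using assms
  by (induction A) (simp_all add: closed vsum_insert vsum_closed add_zero add_assoc add_left_commute)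

lemma vsum_scale:
  assumes "finite A" "\<And>b. b \<in> A \<Longrightarrow> a b \<in> carrier V"
  shows "vsum (\<lambda>b. vscale V k (a b)) A = vscale V k (vsum a A)"
  using assms
  by (induction A) (simp_all add: closed vsum_insert vsum_closed scale_zero_right scale_add)

text \<open>Lets sums over different supports be compared over one common finite index set.\<close>

lemma vsum_mono_neutral:
  assumes "finite B" "A \<subseteq> B" "\<And>b. b \<in> B - A \<Longrightarrow> a b = vzero V"
  shows "vsum a B = vsum a A"
proof -
  have "vsum a (A \<union> D) = vsum a A" if "finite D" "D \<inter> A = {}" "\<And>b. b \<in> D \<Longrightarrow> a b = vzero V" for D
    using that
  proof (induction D)
    case (insert d D)
    then show ?case
      using finite_subset[OF assms(2,1)] by (simp add: vsum_insert closed zero_add vsum_closed)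
  qed simp
  from this[of "B - A"] show ?thesis
    using assms by (simp add: Un_absorb1 Int_commute)
qed

definition linear_ext :: "('b \<Rightarrow> 'v) \<Rightarrow> ('b \<Rightarrow>\<^sub>0 'k) \<Rightarrow> 'v" where
  "linear_ext h c = vsum (\<lambda>b. vscale V (Poly_Mapping.lookup c b) (h b)) (Poly_Mapping.keys c)"

lemma linear_ext_closed: "linear_ext h c \<in> carrier V"
  by (simp add: linear_ext_def vsum_closed)

lemma linear_ext_eq_vsum:
  assumes "finite A" "Poly_Mapping.keys c \<subseteq> A" "\<And>b. b \<in> A \<Longrightarrow> h b \<in> carrier V"
  shows "linear_ext h c = vsum (\<lambda>b. vscale V (Poly_Mapping.lookup c b) (h b)) A"
  unfolding linear_ext_def using assms
  by (intro vsum_mono_neutral[symmetric]) (auto simp: in_keys_iff scale_zero_left)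

lemma linear_ext_add:
  assumes "\<And>b. b \<in> B \<Longrightarrow> h b \<in> carrier V" "Poly_Mapping.keys c \<subseteq> B" "Poly_Mapping.keys d \<subseteq> B"
  shows "linear_ext h (c + d) = vadd V (linear_ext h c) (linear_ext h d)"
proof -
  \<comment> \<open>Cancellation may shrink the support of \<open>c + d\<close>; the union of the
    two supports carries all three sums.\<close>
  define A where "A = Poly_Mapping.keys c \<union> Poly_Mapping.keys d"
  have A: "finite A" "Poly_Mapping.keys c \<subseteq> A" "Poly_Mapping.keys d \<subseteq> A" "Poly_Mapping.keys (c + d) \<subseteq> A"
    using Poly_Mapping.keys_add[of c d] by (auto simp: A_def)
  have h: "h b \<in> carrier V" if "b \<in> A" for b
    using that assms by (auto simp: A_def)
  show ?thesis
    using A h by (simp add: linear_ext_eq_vsum[of A] flip: vsum_add[OF A(1)] add: closed)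
      (auto intro!: vsum_cong simp: lookup_add add_scale)
qed

lemma linear_ext_scale:
  assumes "\<And>b. b \<in> B \<Longrightarrow> h b \<in> carrier V" "Poly_Mapping.keys c \<subseteq> B"
  shows "linear_ext h (free_scale k c) = vscale V k (linear_ext h c)"
proof -
  let ?A = "Poly_Mapping.keys c"
  have A: "finite ?A" "Poly_Mapping.keys (free_scale k c) \<subseteq> ?A"
    by (auto simp: in_keys_iff)
  have h: "h b \<in> carrier V" if "b \<in> ?A" for b
    using that assms by auto
  show ?thesis
    using A h by (simp add: linear_ext_eq_vsum[of ?A] flip: vsum_scale[OF A(1)] add: closed)
      (auto intro!: vsum_cong simp: scale_scale)
qed

lemma linear_ext_single:
  assumes "h b \<in> carrier V"
  shows "linear_ext h (Poly_Mapping.single b 1) = h b"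
  using assms by (simp add: linear_ext_def vsum_insert closed scale_one add_zero)

end

section \<open>Formal linear combinations and their quotient, the tensor product\<close>

interpretation free: vector_space "free_scale :: 'k::field \<Rightarrow> ('b \<Rightarrow>\<^sub>0 'k) \<Rightarrow> _"
  by (rule vector_space_free_scale)

lemma keys_free_scale: "Poly_Mapping.keys (free_scale k c) \<subseteq> Poly_Mapping.keys c"
  by (auto simp: in_keys_iff)

lemma free_space_simps:
  "carrier (free_space B) = {c. Poly_Mapping.keys c \<subseteq> B}"
  "vadd (free_space B) = (+)" "vzero (free_space B) = 0" "vscale (free_space B) = free_scale"
  "vsub (free_space B) c d = c - d"
  by (simp_all add: free_space_def vsub_def)

lemma vspace_mod_free_space:
  fixes B :: "'a set" and R :: "('a \<Rightarrow>\<^sub>0 'b::field) set"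
  shows "vspace_mod (free_space B) (free.span R) (\<lambda>c d. c - d \<in> free.span R)"
proof (unfold_locales; unfold free_space_simps mem_Collect_eq)
  fix c d :: "'a \<Rightarrow>\<^sub>0 'b" and k :: 'b
  show "Poly_Mapping.keys (c + d) \<subseteq> B" if "Poly_Mapping.keys c \<subseteq> B" "Poly_Mapping.keys d \<subseteq> B"
    using that Poly_Mapping.keys_add[of c d] by blast
  show "Poly_Mapping.keys (free_scale k c) \<subseteq> B" if "Poly_Mapping.keys c \<subseteq> B"
    using that keys_free_scale[of k c] by blast
  show "d - c \<in> free.span R" if "c - d \<in> free.span R"
    using free.span_neg[OF that] by simp
  show "free_scale k c - free_scale k d \<in> free.span R" if "c - d \<in> free.span R"
    using free.span_scale[OF that, of k] by (simp add: free.scale_right_diff_distrib)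
next
  fix c d e :: "'a \<Rightarrow>\<^sub>0 'b"
  assume "c - d \<in> free.span R" "d - e \<in> free.span R"
  then show "c - e \<in> free.span R"
    using free.span_add by fastforce
next
  fix c c' d d' :: "'a \<Rightarrow>\<^sub>0 'b"
  assume "c - c' \<in> free.span R" "d - d' \<in> free.span R"
  then show "c + d - (c' + d') \<in> free.span R"
    using free.span_add by (simp add: add_diff_add)
qed (simp_all add: free.span_zero free.scale_right_distrib free.scale_left_distrib algebra_simps)

lemma vspace_tensor_space: "vspace (tensor_space V W)"
  unfolding tensor_space_def by (rule vspace_mod.vspace_quot[OF vspace_mod_free_space])

lemma tensor_closed:
  assumes "x \<in> carrier V" "y \<in> carrier W"
  shows "tensor V W x y \<in> carrier (tensor_space V W)"
  using assms by (simp add: tensor_space_def tensor_def quot_space_def free_space_simps)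

text \<open>The map \<open>\<beta>\<close> extends linearly to formal combinations of pairs,
  bilinearity sends every relator to zero, and so the extension descends to the quotient. The
  existence obtained here is what justifies the choice in \<open>tensor_to_Bochner\<close>.\<close>

lemma tensor_universal:
  fixes V :: "('k::field, 'v, 'm) vect_space_scheme" and W :: "('k, 'w, 'n) vect_space_scheme"
    and Z :: "('k, 'z, 'o) vect_space_scheme"
  assumes V: "vspace V" and W: "vspace W" and Z: "vspace Z"
    and closed: "\<And>x y. \<lbrakk>x \<in> carrier V; y \<in> carrier W\<rbrakk> \<Longrightarrow> \<beta> x y \<in> carrier Z"
    and add_left: "\<And>x x' y. \<lbrakk>x \<in> carrier V; x' \<in> carrier V; y \<in> carrier W\<rbrakk> \<Longrightarrow>
      \<beta> (vadd V x x') y = vadd Z (\<beta> x y) (\<beta> x' y)"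
    and add_right: "\<And>x y y'. \<lbrakk>x \<in> carrier V; y \<in> carrier W; y' \<in> carrier W\<rbrakk> \<Longrightarrow>
      \<beta> x (vadd W y y') = vadd Z (\<beta> x y) (\<beta> x y')"
    and scale_left: "\<And>a x y. \<lbrakk>x \<in> carrier V; y \<in> carrier W\<rbrakk> \<Longrightarrow>
      \<beta> (vscale V a x) y = vscale Z a (\<beta> x y)"
    and scale_right: "\<And>a x y. \<lbrakk>x \<in> carrier V; y \<in> carrier W\<rbrakk> \<Longrightarrow>
      \<beta> x (vscale W a y) = vscale Z a (\<beta> x y)"
  shows "\<exists>\<phi>. is_linear (tensor_space V W) Z \<phi> \<and>
    (\<forall>x\<in>carrier V. \<forall>y\<in>carrier W. \<phi> (tensor V W x y) = \<beta> x y)"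
proof -
  interpret V: vspace V by fact
  interpret W: vspace W by fact
  interpret Z: vspace Z by fact
  define B where "B = carrier V \<times> carrier W"
  define R where "R = tensor_relators V W"
  interpret F: vspace_mod "free_space B" "free.span R" "\<lambda>c d. c - d \<in> free.span R"
    by (rule vspace_mod_free_space)
  define g where "g = Z.linear_ext (case_prod \<beta>)"
  have h: "case_prod \<beta> b \<in> carrier Z" if "b \<in> B" for b
    using that closed by (auto simp: B_def)
  have g_closed: "g c \<in> carrier Z" for c
    by (simp add: g_def Z.linear_ext_closed)
  have g_add: "g (c + d) = vadd Z (g c) (g d)" if "Poly_Mapping.keys c \<subseteq> B" "Poly_Mapping.keys d \<subseteq> B" for c d
    unfolding g_def using h that by (rule Z.linear_ext_add)
  have g_scale: "g (free_scale k c) = vscale Z k (g c)" if "Poly_Mapping.keys c \<subseteq> B" for c k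
    unfolding g_def using h that by (rule Z.linear_ext_scale)
  have g_single: "g (Poly_Mapping.single (x, y) 1) = \<beta> x y" if "x \<in> carrier V" "y \<in> carrier W" for x y
    using closed[OF that] by (simp add: g_def Z.linear_ext_single)
  have g_minus: "g (c - d) = vsub Z (g c) (g d)" if "Poly_Mapping.keys c \<subseteq> B" "Poly_Mapping.keys d \<subseteq> B" for c d
  proof -
    have "Poly_Mapping.keys (free_scale (-1) d) \<subseteq> B"
      using that keys_free_scale[of "-1" d] by blast
    with that have "g (c + free_scale (-1) d) = vsub Z (g c) (g d)"
      by (simp only: g_add g_scale vsub_def)
    then show ?thesis by simp
  qed
  \<comment> \<open>The kernel of \<open>g\<close> among combinations supported in \<open>B\<close>.
    The support condition is part of \<open>K\<close> because \<open>g_add\<close> and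
    \<open>g_scale\<close> are available only there.\<close>
  define K where "K = {c. Poly_Mapping.keys c \<subseteq> B \<and> g c = vzero Z}"
  have "free.subspace K"
  proof (rule free.subspaceI)
    show "0 \<in> K"
      by (simp add: K_def g_def Z.linear_ext_def)
    show "c + d \<in> K" if "c \<in> K" "d \<in> K" for c d
      using that Poly_Mapping.keys_add[of c d] by (auto simp: K_def g_add Z.closed Z.add_zero)
    show "free_scale k c \<in> K" if "c \<in> K" for k c
      using that keys_free_scale[of k c] by (auto simp: K_def g_scale Z.scale_zero_right)
  qed
  \<comment> \<open>Every relator is a difference of two combinations on which \<open>g\<close>
    agrees; \<open>diff_diff_eq\<close> brings the two additive families into this shape.\<close>
  moreover have "R \<subseteq> K"
  proof
    have e: "(x, y) \<in> B"
      if "x \<in> carrier V" "y \<in> carrier W" for x y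
      using that by (simp add: B_def)
    have sub: "c - d \<in> K" if "Poly_Mapping.keys c \<subseteq> B" "Poly_Mapping.keys d \<subseteq> B" "g c = g d" for c d
      using that Poly_Mapping.keys_diff[of c d] by (auto simp: K_def g_minus Z.sub_self g_closed)
    have add: "Poly_Mapping.keys (c + d) \<subseteq> B"
      if "Poly_Mapping.keys c \<subseteq> B" "Poly_Mapping.keys d \<subseteq> B" for c d :: "_ \<Rightarrow>\<^sub>0 'k"
      using that Poly_Mapping.keys_add[of c d] by blast
    have scale: "Poly_Mapping.keys (free_scale k c) \<subseteq> B" if "Poly_Mapping.keys c \<subseteq> B" for k and c :: "_ \<Rightarrow>\<^sub>0 'k"
      using that keys_free_scale[of k c] by blast
    fix r assume "r \<in> R"
    then show "r \<in> K"
      unfolding R_def tensor_relators_def Let_def diff_diff_eq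
      by (auto intro!: sub scale dest!: subsetD[OF Poly_Mapping.keys_add]
          simp: e add V.closed W.closed g_add g_scale g_single
          add_left add_right scale_left scale_right)
  qed
  ultimately have span: "free.span R \<subseteq> K"
    by (intro free.span_minimal)
  have g_cong: "g c = g d"
    if "Poly_Mapping.keys c \<subseteq> B" "Poly_Mapping.keys d \<subseteq> B" "c - d \<in> free.span R" for c d
    using that span g_minus[of c d] Z.sub_eq_zero_iff[OF g_closed g_closed, of c d]
    by (auto simp: K_def)
  \<comment> \<open>An arbitrary representative will do, since \<open>g_cong\<close> makes
    \<open>g\<close> constant on cosets.\<close>
  define \<phi> where "\<phi> A = g (SOME c. c \<in> A)" for A
  have \<phi>_coset: "\<phi> (coset (free_space B) (free.span R) c) = g c" if "Poly_Mapping.keys c \<subseteq> B" for c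
  proof -
    have c: "c \<in> carrier (free_space B)"
      using that by (simp add: free_space_simps)
    have "(SOME d. d \<in> coset (free_space B) (free.span R) c) \<in> coset (free_space B) (free.span R) c"
      by (rule someI[of _ c]) (rule F.self_mem_coset[OF c])
    then show ?thesis
      unfolding \<phi>_def using that by (intro g_cong) (auto simp: F.mem_coset_iff[OF c] free_space_simps)
  qed
  have eq: "tensor_space V W = quot_space (free_space B) (free.span R)"
    "tensor V W x y = coset (free_space B) (free.span R) (Poly_Mapping.single (x, y) 1)" for x y
    by (simp_all add: tensor_space_def tensor_def B_def R_def)
  have "is_linear (tensor_space V W) Z \<phi>"
    unfolding is_linear_def eq F.quot_carrier ball_simps
    using F.closed
    by (simp add: F.quot_add F.quot_scale) (simp add: free_space_simps \<phi>_coset g_closed g_add g_scale)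
  moreover have "\<phi> (tensor V W x y) = \<beta> x y" if "x \<in> carrier V" "y \<in> carrier W" for x y
    unfolding eq using that by (subst \<phi>_coset) (simp_all add: g_single B_def)
  ultimately show ?thesis by blast
qed


section \<open>Lebesgue and Bochner spaces\<close>

lemma mem_Lp_funs_iff: "f \<in> carrier (Lp_funs M p) \<longleftrightarrow> Lp_fun p M f"
  by (simp add: Lp_funs_def Lp_fun_def)

lemma Lp_funs_simps:
  "vadd (Lp_funs M p) f g = (\<lambda>s. f s + g s)" "vzero (Lp_funs M p) = (\<lambda>s. 0)"
  "vscale (Lp_funs M p) a f = (\<lambda>s. a * f s)"
  "vnorm (Lp_funs M p) f = (\<integral>s. norm (f s) powr p \<partial>M) powr (1 / p)"
  "vsub (Lp_funs M p) f g = (\<lambda>s. f s - g s)"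
  by (simp_all add: Lp_funs_def vsub_def)

lemma seminormed_mod_Lp_funs:
  assumes "1 \<le> p"
  shows "seminormed_mod (Lp_funs M p :: ('k::{real_normed_field, euclidean_space}, 's \<Rightarrow> 'k) norm_space)
    {f \<in> carrier (Lp_funs M p). AE s in M. f s = 0} (\<lambda>f g. AE s in M. f s = g s)"
proof (unfold_locales; unfold mem_Lp_funs_iff Lp_funs_simps)
  have p: "0 \<le> p" using assms by simp
  fix f g :: "'s \<Rightarrow> 'k" and a :: 'k
  show "Lp_fun p M (\<lambda>s. 0 :: 'k)"
    by (rule Lp_fun_zero)
  assume f: "Lp_fun p M f"
  then show scale: "Lp_fun p M (\<lambda>s. a * f s)"
    by (rule Lp_fun_mult)
  have [measurable]: "f \<in> borel_measurable M"
    using f by (rule Lp_fun_measurable)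
  show "0 \<le> (\<integral>s. norm (f s) powr p \<partial>M) powr (1 / p)"
    by simp
  show "(\<integral>s. norm (a * f s) powr p \<partial>M) powr (1 / p) = norm a * (\<integral>s. norm (f s) powr p \<partial>M) powr (1 / p)"
    using assms by (simp add: norm_mult powr_mult powr_powr)
  assume g: "Lp_fun p M g"
  then have [measurable]: "g \<in> borel_measurable M"
    by (rule Lp_fun_measurable)
  show "Lp_fun p M (\<lambda>s. f s + g s)"
    using p f g by (rule Lp_fun_add)
  have "Lp_fun p M (\<lambda>s. f s - g s)"
    using Lp_fun_add[OF p f Lp_fun_mult[OF g, of "-1"]] by simp
  then show "(\<lambda>s. f s - g s) \<in> {f. Lp_fun p M f \<and> (AE s in M. f s = 0)} \<longleftrightarrow> (AE s in M. f s = g s)"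
    by simp
  show "(\<integral>s. norm (f s) powr p \<partial>M) powr (1 / p) = (\<integral>s. norm (g s) powr p \<partial>M) powr (1 / p)"
    if "AE s in M. f s = g s"
  proof -
    have "(\<integral>s. norm (f s) powr p \<partial>M) = (\<integral>s. norm (g s) powr p \<partial>M)"
      using that by (intro integral_cong_AE) auto
    then show ?thesis by simp
  qed
  have "(\<integral>s. norm (f s + g s) powr p \<partial>M) powr (1 / p)
      \<le> (\<integral>s. (norm (f s) + norm (g s)) powr p \<partial>M) powr (1 / p)"
    using p f g by (intro powr_mono2 integral_mono integrable_norm_add_powr Lp_fun_integrable Lp_fun_add)
      (auto intro: norm_triangle_ineq)
  also have "\<dots> \<le> (\<integral>s. norm (f s) powr p \<partial>M) powr (1 / p) + (\<integral>s. norm (g s) powr p \<partial>M) powr (1 / p)"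
    using assms f g by (intro Minkowski_inequality) (auto simp: Lp_fun_integrable)
  finally show "(\<integral>s. norm (f s + g s) powr p \<partial>M) powr (1 / p)
      \<le> (\<integral>s. norm (f s) powr p \<partial>M) powr (1 / p) + (\<integral>s. norm (g s) powr p \<partial>M) powr (1 / p)" .
qed (auto simp: algebra_simps)

lemma seminormed_Lp:
  assumes "1 \<le> p"
  shows "seminormed (Lp M p :: ('k::{real_normed_field, euclidean_space}, ('s \<Rightarrow> 'k) set) norm_space)"
  unfolding Lp_def by (rule seminormed_mod.seminormed_norm_quot[OF seminormed_mod_Lp_funs[OF assms]])

section \<open>Strong measurability and Bochner spaces\<close>

lemma strongly_measurableI:
  assumes "\<And>n. simple_function M (\<phi> n)" "\<And>n s. s \<in> space M \<Longrightarrow> \<phi> n s \<in> carrier X"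
    and "\<And>s. s \<in> space M \<Longrightarrow> u s \<in> carrier X"
    and "\<And>s. s \<in> space M \<Longrightarrow> (\<lambda>n. vnorm X (vsub X (\<phi> n s) (u s))) \<longlonglongrightarrow> 0"
  shows "strongly_measurable M X u"
  using assms unfolding strongly_measurable_def by blast

lemma strongly_measurableE:
  assumes "strongly_measurable M X u"
  obtains \<phi> where "\<And>n. simple_function M (\<phi> n)" "\<And>n s. s \<in> space M \<Longrightarrow> \<phi> n s \<in> carrier X"
    "\<And>s. s \<in> space M \<Longrightarrow> (\<lambda>n. vnorm X (vsub X (\<phi> n s) (u s))) \<longlonglongrightarrow> 0"
proof -
  from assms obtain \<phi> where "\<forall>n. simple_function M (\<phi> n) \<and> \<phi> n \<in> space M \<rightarrow> carrier X"
    "\<forall>s\<in>space M. (\<lambda>n. vnorm X (vsub X (\<phi> n s) (u s))) \<longlonglongrightarrow> 0"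
    unfolding strongly_measurable_def by blast
  then show thesis
    by (intro that[of \<phi>]) (auto simp: Pi_iff)
qed

lemma strongly_measurable_carrier:
  "\<lbrakk>strongly_measurable M X u; s \<in> space M\<rbrakk> \<Longrightarrow> u s \<in> carrier X"
  by (auto simp: strongly_measurable_def)

context seminormed
begin

text \<open>Norms of the simple approximants are real simple functions and converge to the norm of
  \<open>u\<close> by the reverse triangle inequality. For \<open>V = Lp N p\<close> this is the
  source of measurability in the outer variable of the iterated integral.\<close>

lemma borel_measurable_vnorm:
  assumes "strongly_measurable M V u"
  shows "(\<lambda>s. vnorm V (u s)) \<in> borel_measurable M"
proof -
  obtain \<phi> where \<phi>: "\<And>n. simple_function M (\<phi> n)" "\<And>n s. s \<in> space M \<Longrightarrow> \<phi> n s \<in> carrier V"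
    "\<And>s. s \<in> space M \<Longrightarrow> (\<lambda>n. vnorm V (vsub V (\<phi> n s) (u s))) \<longlonglongrightarrow> 0"
    using strongly_measurableE[OF assms] by metis
  show ?thesis
  proof (rule borel_measurable_LIMSEQ_real)
    show "(\<lambda>s. vnorm V (\<phi> n s)) \<in> borel_measurable M" for n
      using simple_function_compose1[OF \<phi>(1), of "vnorm V"] by (rule borel_measurable_simple_function)
    fix s assume s: "s \<in> space M"
    have "(\<lambda>n. vnorm V (\<phi> n s) - vnorm V (u s)) \<longlonglongrightarrow> 0"
      by (rule Lim_null_comparison[OF _ \<phi>(3)[OF s]])
        (use s \<phi>(2) strongly_measurable_carrier[OF assms] in \<open>simp add: norm_diff_le\<close>)
    then show "(\<lambda>n. vnorm V (\<phi> n s)) \<longlonglongrightarrow> vnorm V (u s)"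
      by (simp add: LIM_zero_iff)
  qed
qed

lemma strongly_measurable_zero: "strongly_measurable M V (\<lambda>s. vzero V)"
  by (rule strongly_measurableI[of _ "\<lambda>_ _. vzero V"]) (simp_all add: closed sub_self norm_zero)

lemma strongly_measurable_add:
  assumes "strongly_measurable M V u" "strongly_measurable M V v"
  shows "strongly_measurable M V (\<lambda>s. vadd V (u s) (v s))"
proof -
  obtain \<phi> where \<phi>: "\<And>n. simple_function M (\<phi> n)" "\<And>n s. s \<in> space M \<Longrightarrow> \<phi> n s \<in> carrier V"
    "\<And>s. s \<in> space M \<Longrightarrow> (\<lambda>n. vnorm V (vsub V (\<phi> n s) (u s))) \<longlonglongrightarrow> 0"
    using strongly_measurableE[OF assms(1)] by metis
  obtain \<psi> where \<psi>: "\<And>n. simple_function M (\<psi> n)" "\<And>n s. s \<in> space M \<Longrightarrow> \<psi> n s \<in> carrier V"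
    "\<And>s. s \<in> space M \<Longrightarrow> (\<lambda>n. vnorm V (vsub V (\<psi> n s) (v s))) \<longlonglongrightarrow> 0"
    using strongly_measurableE[OF assms(2)] by metis
  note C = strongly_measurable_carrier[OF assms(1)] strongly_measurable_carrier[OF assms(2)]
  show ?thesis
  proof (rule strongly_measurableI)
    show "simple_function M (\<lambda>s. vadd V (\<phi> n s) (\<psi> n s))" for n
      using \<phi>(1) \<psi>(1) by (rule simple_function_compose2)
    fix s assume s: "s \<in> space M"
    show "(\<lambda>n. vnorm V (vsub V (vadd V (\<phi> n s) (\<psi> n s)) (vadd V (u s) (v s)))) \<longlonglongrightarrow> 0"
      by (rule Lim_null_comparison[OF _ tendsto_add_zero[OF \<phi>(3)[OF s] \<psi>(3)[OF s]]])
        (use s C \<phi>(2) \<psi>(2) in \<open>simp add: norm_add_sub_add norm_nonneg sub_closed closed\<close>)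
  qed (use C \<phi>(2) \<psi>(2) in \<open>auto intro: closed\<close>)
qed

lemma strongly_measurable_scale:
  assumes "strongly_measurable M V u"
  shows "strongly_measurable M V (\<lambda>s. vscale V a (u s))"
proof -
  obtain \<phi> where \<phi>: "\<And>n. simple_function M (\<phi> n)" "\<And>n s. s \<in> space M \<Longrightarrow> \<phi> n s \<in> carrier V"
    "\<And>s. s \<in> space M \<Longrightarrow> (\<lambda>n. vnorm V (vsub V (\<phi> n s) (u s))) \<longlonglongrightarrow> 0"
    using strongly_measurableE[OF assms(1)] by metis
  note C = strongly_measurable_carrier[OF assms]
  show ?thesis
  proof (rule strongly_measurableI)
    show "simple_function M (\<lambda>s. vscale V a (\<phi> n s))" for n
      using \<phi>(1) by (rule simple_function_compose1)
    fix s assume s: "s \<in> space M"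
    show "(\<lambda>n. vnorm V (vsub V (vscale V a (\<phi> n s)) (vscale V a (u s)))) \<longlonglongrightarrow> 0"
      using tendsto_mult_right_zero[OF \<phi>(3)[OF s], of "norm a"] s C \<phi>(2) by (simp add: norm_scale_sub_scale)
  qed (use C \<phi>(2) in \<open>auto intro: closed\<close>)
qed

lemma sub_scale_left:
  assumes "x \<in> carrier V"
  shows "vsub V (vscale V a x) (vscale V b x) = vscale V (a - b) x"
  using add_scale[OF assms, of a "- b"] assms by (simp add: vsub_def scale_scale)

text \<open>Simple approximants of the scalar function, multiplied by the fixed vector, approximate
  the product. They form a hypothesis because the scalars are merely a normed field in this locale;
  over Euclidean scalars Borel measurability provides them.\<close>

lemma strongly_measurable_scale_const:
  fixes f :: "'s \<Rightarrow> 'k"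
  assumes sc: "\<exists>\<phi>. (\<forall>n::nat. simple_function M (\<phi> n)) \<and>
      (\<forall>s\<in>space M. (\<lambda>n. \<phi> n s) \<longlonglongrightarrow> f s)" and x: "x \<in> carrier V"
  shows "strongly_measurable M V (\<lambda>s. vscale V (f s) x)"
proof -
  obtain \<phi> where \<phi>: "\<And>n::nat. simple_function M (\<phi> n)" "\<And>s. s \<in> space M \<Longrightarrow> (\<lambda>n. \<phi> n s) \<longlonglongrightarrow> f s"
    using sc by metis
  show ?thesis
  proof (rule strongly_measurableI)
    show "simple_function M (\<lambda>s. vscale V (\<phi> n s) x)" for n
      using \<phi>(1) by (rule simple_function_compose1)
    fix s assume s: "s \<in> space M"
    have "(\<lambda>n. norm (\<phi> n s - f s) * vnorm V x) \<longlonglongrightarrow> 0"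
      using LIM_zero[OF \<phi>(2)[OF s]] by (intro tendsto_mult_left_zero tendsto_norm_zero)
    then show "(\<lambda>n. vnorm V (vsub V (vscale V (\<phi> n s) x) (vscale V (f s) x))) \<longlonglongrightarrow> 0"
      using x by (simp add: sub_scale_left norm_scale)
  qed (use x in \<open>auto intro: closed\<close>)
qed

lemma Bochner_simps:
  "u \<in> carrier (Bochner_Lp_funs M p V) \<longleftrightarrow>
    strongly_measurable M V u \<and> integrable M (\<lambda>s. vnorm V (u s) powr p)"
  "vadd (Bochner_Lp_funs M p V) u v = (\<lambda>s. vadd V (u s) (v s))"
  "vzero (Bochner_Lp_funs M p V) = (\<lambda>s. vzero V)"
  "vscale (Bochner_Lp_funs M p V) a u = (\<lambda>s. vscale V a (u s))"
  "vnorm (Bochner_Lp_funs M p V) u = (\<integral>s. vnorm V (u s) powr p \<partial>M) powr (1 / p)"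
  "vsub (Bochner_Lp_funs M p V) u v = (\<lambda>s. vsub V (u s) (v s))"
  by (simp_all add: Bochner_Lp_funs_def vsub_def)

lemma integrable_vnorm_scale:
  assumes "strongly_measurable M V u" "integrable M (\<lambda>s. vnorm V (u s) powr p)"
  shows "integrable M (\<lambda>s. vnorm V (vscale V a (u s)) powr p)"
proof -
  have "integrable M (\<lambda>s. norm a powr p * vnorm V (u s) powr p)"
    using assms(2) by simp
  also have "?this \<longleftrightarrow> ?thesis"
    using strongly_measurable_carrier[OF assms(1)]
    by (intro Bochner_Integration.integrable_cong) (auto simp: norm_scale powr_mult norm_nonneg)
  finally show ?thesis .
qed

text \<open>The first function is the majorant for the second, and it reappears as the middle term
  in the triangle inequality of the Bochner norm.\<close>

lemma integrable_vnorm_add: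
  assumes "0 \<le> p" "strongly_measurable M V u" "integrable M (\<lambda>s. vnorm V (u s) powr p)"
    and "strongly_measurable M V v" "integrable M (\<lambda>s. vnorm V (v s) powr p)"
  shows "integrable M (\<lambda>s. (vnorm V (u s) + vnorm V (v s)) powr p)"
    and "integrable M (\<lambda>s. vnorm V (vadd V (u s) (v s)) powr p)"
proof -
  note C = strongly_measurable_carrier[OF assms(2)] strongly_measurable_carrier[OF assms(4)]
  note [measurable] = borel_measurable_vnorm[OF assms(2)] borel_measurable_vnorm[OF assms(4)]
    borel_measurable_vnorm[OF strongly_measurable_add[OF assms(2,4)]]
  show int: "integrable M (\<lambda>s. (vnorm V (u s) + vnorm V (v s)) powr p)"
    using assms C by (intro integrable_add_powr) (auto simp: norm_nonneg)
  show "integrable M (\<lambda>s. vnorm V (vadd V (u s) (v s)) powr p)"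
    using C assms(1) by (intro Bochner_Integration.integrable_bound[OF int] AE_I2)
      (auto intro!: powr_mono2 norm_triangle norm_nonneg closed)
qed

text \<open>The laws of \<open>V\<close> hold at each point of the space of \<open>M\<close>, hence
  almost everywhere. The triangle inequality is the one of \<open>V\<close> taken pointwise,
  followed by Minkowski's inequality for the real functions
  \<open>s \<mapsto> vnorm V (u s)\<close>.\<close>

lemma seminormed_mod_Bochner:
  fixes M :: "'s measure"
  assumes "1 \<le> p"
  shows "seminormed_mod (Bochner_Lp_funs M p V) (Bochner_null_funs M p V) (\<lambda>u v. AE s in M. u s = v s)"
proof -
  have p: "0 \<le> p" using assms by simp
  note C = strongly_measurable_carrier[of M V]
  show ?thesis
  proof (unfold_locales; unfold Bochner_simps)
    fix u v :: "'s \<Rightarrow> 'v" and a :: 'k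
    show "strongly_measurable M V (\<lambda>s. vzero V) \<and> integrable M (\<lambda>s. vnorm V (vzero V) powr p)"
      by (simp add: strongly_measurable_zero norm_zero)
    assume u: "strongly_measurable M V u \<and> integrable M (\<lambda>s. vnorm V (u s) powr p)"
    then show "strongly_measurable M V (\<lambda>s. vscale V a (u s)) \<and>
        integrable M (\<lambda>s. vnorm V (vscale V a (u s)) powr p)"
      by (simp add: strongly_measurable_scale integrable_vnorm_scale)
    show "0 \<le> (\<integral>s. vnorm V (u s) powr p \<partial>M) powr (1 / p)"
      by simp
    have "(\<integral>s. vnorm V (vscale V a (u s)) powr p \<partial>M) = (\<integral>s. norm a powr p * vnorm V (u s) powr p \<partial>M)"
      using u by (intro Bochner_Integration.integral_cong) (auto simp: C norm_scale powr_mult norm_nonneg)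
    then show "(\<integral>s. vnorm V (vscale V a (u s)) powr p \<partial>M) powr (1 / p)
        = norm a * (\<integral>s. vnorm V (u s) powr p \<partial>M) powr (1 / p)"
      using assms by (simp add: powr_mult powr_powr)
    assume v: "strongly_measurable M V v \<and> integrable M (\<lambda>s. vnorm V (v s) powr p)"
    show add: "strongly_measurable M V (\<lambda>s. vadd V (u s) (v s)) \<and>
        integrable M (\<lambda>s. vnorm V (vadd V (u s) (v s)) powr p)"
      using u v by (simp add: strongly_measurable_add integrable_vnorm_add p)
    have "strongly_measurable M V (\<lambda>s. vsub V (u s) (v s)) \<and>
        integrable M (\<lambda>s. vnorm V (vsub V (u s) (v s)) powr p)"
      unfolding vsub_def
      using u v strongly_measurable_scale[of M v "-1"] integrable_vnorm_scale[of M v p "-1"]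
      by (simp add: strongly_measurable_add integrable_vnorm_add p)
    then have "(\<lambda>s. vsub V (u s) (v s)) \<in> Bochner_null_funs M p V
        \<longleftrightarrow> (AE s in M. vsub V (u s) (v s) = vzero V)"
      by (simp add: Bochner_null_funs_def Bochner_simps)
    also have "\<dots> \<longleftrightarrow> (AE s in M. u s = v s)"
      using u v by (intro AE_cong) (auto simp: sub_eq_zero_iff C)
    finally show "(\<lambda>s. vsub V (u s) (v s)) \<in> Bochner_null_funs M p V \<longleftrightarrow> (AE s in M. u s = v s)" .
    show "(\<integral>s. vnorm V (u s) powr p \<partial>M) powr (1 / p) = (\<integral>s. vnorm V (v s) powr p \<partial>M) powr (1 / p)"
      if "AE s in M. u s = v s"
    proof -
      have [measurable]: "(\<lambda>s. vnorm V (u s)) \<in> borel_measurable M" "(\<lambda>s. vnorm V (v s)) \<in> borel_measurable M"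
        using u v by (auto intro: borel_measurable_vnorm)
      have "(\<integral>s. vnorm V (u s) powr p \<partial>M) = (\<integral>s. vnorm V (v s) powr p \<partial>M)"
        using that by (intro integral_cong_AE) auto
      then show ?thesis by simp
    qed
    have uv: "u s \<in> carrier V" "v s \<in> carrier V" if "s \<in> space M" for s
      using u v that by (auto intro: C)
    have "(\<integral>s. vnorm V (vadd V (u s) (v s)) powr p \<partial>M) powr (1 / p)
        \<le> (\<integral>s. (vnorm V (u s) + vnorm V (v s)) powr p \<partial>M) powr (1 / p)"
      using p u v
      by (intro powr_mono2 integral_mono integrable_vnorm_add) (auto intro!: norm_triangle norm_nonneg closed uv)
    also have "\<dots> \<le> (\<integral>s. vnorm V (u s) powr p \<partial>M) powr (1 / p) + (\<integral>s. vnorm V (v s) powr p \<partial>M) powr (1 / p)"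
      using assms u v by (intro Minkowski_inequality borel_measurable_vnorm) (auto intro!: norm_nonneg uv)
    finally show "(\<integral>s. vnorm V (vadd V (u s) (v s)) powr p \<partial>M) powr (1 / p)
        \<le> (\<integral>s. vnorm V (u s) powr p \<partial>M) powr (1 / p) + (\<integral>s. vnorm V (v s) powr p \<partial>M) powr (1 / p)" .
    show "AE s in M. vadd V (u s) (v s) = vadd V (v s) (u s)"
      using u v by (intro AE_I2 add_commute) (auto intro!: C)
    show "AE s in M. vscale V a (vadd V (u s) (v s)) = vadd V (vscale V a (u s)) (vscale V a (v s))"
      using u v by (intro AE_I2 scale_add) (auto intro!: C)
  next
    fix u and a b :: 'k assume u: "strongly_measurable M V u \<and> integrable M (\<lambda>s. vnorm V (u s) powr p)"
    show "AE s in M. vadd V (u s) (vzero V) = u s"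
      using u by (intro AE_I2 add_zero) (auto intro!: C)
    show "AE s in M. vadd V (u s) (vscale V (-1) (u s)) = vzero V"
      using u by (intro AE_I2 add_inverse) (auto intro!: C)
    show "AE s in M. vscale V (a + b) (u s) = vadd V (vscale V a (u s)) (vscale V b (u s))"
      using u by (intro AE_I2 add_scale) (auto intro!: C)
    show "AE s in M. vscale V a (vscale V b (u s)) = vscale V (a * b) (u s)"
      using u by (intro AE_I2 scale_scale) (auto intro!: C)
    show "AE s in M. vscale V 1 (u s) = u s"
      using u by (intro AE_I2 scale_one) (auto intro!: C)
  next
    fix u v w
    assume "strongly_measurable M V u \<and> integrable M (\<lambda>s. vnorm V (u s) powr p)"
      "strongly_measurable M V v \<and> integrable M (\<lambda>s. vnorm V (v s) powr p)"
      "strongly_measurable M V w \<and> integrable M (\<lambda>s. vnorm V (w s) powr p)"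
    then show "AE s in M. vadd V (vadd V (u s) (v s)) (w s) = vadd V (u s) (vadd V (v s) (w s))"
      by (intro AE_I2 add_assoc) (auto intro!: C)
  qed auto
qed

end


section \<open>Computation with representatives of L^p classes\<close>

definition Lp_class :: "'s measure \<Rightarrow> real \<Rightarrow> ('s \<Rightarrow> 'k::real_normed_field) \<Rightarrow> ('s \<Rightarrow> 'k) set" where
  "Lp_class M p = coset (Lp_funs M p) {f \<in> carrier (Lp_funs M p). AE s in M. f s = 0}"

lemma Lp_E:
  assumes "F \<in> carrier (Lp M p)"
  obtains f where "Lp_fun p M f" "F = Lp_class M p f"
  using assms
  by (auto simp: Lp_def norm_quot_space_def with_norm_def quot_space_def mem_Lp_funs_iff Lp_class_def)

lemma powr_le_powr_iff:
  fixes a b q :: real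
  assumes "0 \<le> a" "0 \<le> b" "0 < q"
  shows "a powr q \<le> b powr q \<longleftrightarrow> a \<le> b"
  using assms by (meson less_eq_real_def not_le powr_less_mono2 powr_mono2)

text \<open>Everything is read off from the quotient construction. In the orthogonality criterion
  the exponent \<open>1 / p\<close> disappears because that power is increasing on the nonnegative
  reals.\<close>

lemma
  fixes f g :: "'s \<Rightarrow> 'k::{real_normed_field, euclidean_space}"
  assumes "1 \<le> p" "Lp_fun p M f"
  shows Lp_class_closed: "Lp_class M p f \<in> carrier (Lp M p)"
    and vscale_Lp_class: "vscale (Lp M p) a (Lp_class M p f) = Lp_class M p (\<lambda>s. a * f s)"
    and vnorm_Lp_class: "vnorm (Lp M p) (Lp_class M p f) = (\<integral>s. norm (f s) powr p \<partial>M) powr (1 / p)"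
    and vadd_Lp_class: "Lp_fun p M g \<Longrightarrow>
      vadd (Lp M p) (Lp_class M p f) (Lp_class M p g) = Lp_class M p (\<lambda>s. f s + g s)"
    and BJ_Lp_class_iff: "Lp_fun p M g \<Longrightarrow> BJ_orthogonal (Lp M p) (Lp_class M p f) (Lp_class M p g) \<longleftrightarrow>
      (\<forall>\<alpha>. (\<integral>s. norm (f s) powr p \<partial>M) \<le> (\<integral>s. norm (f s + \<alpha> * g s) powr p \<partial>M))"
proof -
  interpret L: seminormed_mod "Lp_funs M p :: ('k, 's \<Rightarrow> 'k) norm_space"
      "{f \<in> carrier (Lp_funs M p). AE s in M. f s = 0}" "\<lambda>f g. AE s in M. f s = g s"
    by (rule seminormed_mod_Lp_funs[OF assms(1)])
  have f: "f \<in> carrier (Lp_funs M p)"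
    using assms(2) by (simp add: mem_Lp_funs_iff)
  show "Lp_class M p f \<in> carrier (Lp M p)"
    unfolding Lp_def Lp_class_def L.norm_quot_simps(1) using f by (rule imageI)
  show "vscale (Lp M p) a (Lp_class M p f) = Lp_class M p (\<lambda>s. a * f s)"
    unfolding Lp_def Lp_class_def L.norm_quot_simps(4)[OF f] Lp_funs_simps ..
  show "vnorm (Lp M p) (Lp_class M p f) = (\<integral>s. norm (f s) powr p \<partial>M) powr (1 / p)"
    unfolding Lp_def Lp_class_def L.norm_quot[OF f] Lp_funs_simps ..
  assume "Lp_fun p M g"
  then have g: "g \<in> carrier (Lp_funs M p)"
    by (simp add: mem_Lp_funs_iff)
  show "vadd (Lp M p) (Lp_class M p f) (Lp_class M p g) = Lp_class M p (\<lambda>s. f s + g s)"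
    unfolding Lp_def Lp_class_def L.norm_quot_simps(3)[OF f g] Lp_funs_simps ..
  show "BJ_orthogonal (Lp M p) (Lp_class M p f) (Lp_class M p g) \<longleftrightarrow>
      (\<forall>\<alpha>. (\<integral>s. norm (f s) powr p \<partial>M) \<le> (\<integral>s. norm (f s + \<alpha> * g s) powr p \<partial>M))"
    unfolding Lp_def Lp_class_def L.BJ_norm_quot_iff[OF f g] Lp_funs_simps
    using assms(1) by (simp add: powr_le_powr_iff)
qed

section \<open>The norm \<open>\<Delta>\<^sub>p\<close>\<close>

text \<open>The second factor is kept as a general seminormed space \<open>X\<close>; it becomes
  \<open>Lp N p\<close> only in \<open>BJ_Delta_iff\<close>.\<close>

locale Lp_tensor = seminormed X
  for X :: "('k::{real_normed_field, euclidean_space}, 'v) norm_space" +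
  fixes M :: "'s measure" and p :: real
  assumes p: "1 \<le> p"
begin

sublocale L: seminormed_mod "Lp_funs M p :: ('k, 's \<Rightarrow> 'k) norm_space"
    "{f \<in> carrier (Lp_funs M p). AE s in M. f s = 0}" "\<lambda>f g. AE s in M. f s = g s"
  by (rule seminormed_mod_Lp_funs[OF p])

sublocale Bo: seminormed_mod "Bochner_Lp_funs M p X" "Bochner_null_funs M p X" "\<lambda>u v. AE s in M. u s = v s"
  by (rule seminormed_mod_Bochner[OF p])

abbreviation B_class :: "('s \<Rightarrow> 'v) \<Rightarrow> ('s \<Rightarrow> 'v) set" where
  "B_class \<equiv> coset (Bochner_Lp_funs M p X) (Bochner_null_funs M p X)"

lemmas Lp_simps = Lp_class_closed[OF p] vscale_Lp_class[OF p] vadd_Lp_class[OF p]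
lemmas Bochner_Lp_simps = Bo.norm_quot_simps[folded Bochner_Lp_def] Bo.norm_quot[folded Bochner_Lp_def]

text \<open>Euclidean scalars are separable, so the Borel function \<open>f\<close> is a pointwise
  limit of simple functions, which yields strong measurability of its product with
  \<open>x\<close>.\<close>

lemma Lp_scale_mem_Bochner:
  assumes "Lp_fun p M f" "x \<in> carrier X"
  shows "(\<lambda>s. vscale X (f s) x) \<in> carrier (Bochner_Lp_funs M p X)"
proof -
  have "\<exists>\<phi>. (\<forall>n::nat. simple_function M (\<phi> n)) \<and> (\<forall>s\<in>space M. (\<lambda>n. \<phi> n s) \<longlonglongrightarrow> f s)"
    using borel_measurable_implies_sequence_metric[OF Lp_fun_measurable[OF assms(1)], of 0] by blast
  then have "strongly_measurable M X (\<lambda>s. vscale X (f s) x)"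
    using assms(2) by (rule strongly_measurable_scale_const)
  moreover have "integrable M (\<lambda>s. vnorm X (vscale X (f s) x) powr p)"
    using Lp_fun_integrable[OF assms(1)] assms(2) by (simp add: norm_scale powr_mult norm_nonneg)
  ultimately show ?thesis by (simp add: Bochner_simps)
qed

lemma Lp_times_class:
  assumes "Lp_fun p M f" "x \<in> carrier X"
  shows "Lp_times M p X (Lp_class M p f) x = B_class (\<lambda>s. vscale X (f s) x)"
  unfolding Lp_times_def Lp_class_def
proof (rule L.UN_coset_const)
  fix g assume "g \<in> carrier (Lp_funs M p)" "AE s in M. g s = f s"
  then show "B_class (\<lambda>s. vscale X (g s) x) = B_class (\<lambda>s. vscale X (f s) x)"
    using assms by (intro Bo.coset_eqI Lp_scale_mem_Bochner) (auto simp: mem_Lp_funs_iff)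
qed (use assms in \<open>simp add: mem_Lp_funs_iff\<close>)

text \<open>Bilinearity of \<open>Lp_times\<close> is checked on representatives;
  \<open>tensor_universal\<close> then produces a map with the required properties, so the one
  chosen by \<open>SOME\<close> has them as well.\<close>

lemma tensor_to_Bochner:
  shows "is_linear (tensor_space (Lp M p) X) (Bochner_Lp M p X) (tensor_to_Bochner M p X)"
    and "\<lbrakk>Lp_fun p M f; x \<in> carrier X\<rbrakk> \<Longrightarrow>
      tensor_to_Bochner M p X (tensor (Lp M p) X (Lp_class M p f) x) = B_class (\<lambda>s. vscale X (f s) x)"
proof -
  interpret LQ: seminormed "Lp M p :: ('k, ('s \<Rightarrow> 'k) set) norm_space"
    by (rule seminormed_Lp[OF p])
  interpret BQ: seminormed "Bochner_Lp M p X"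
    unfolding Bochner_Lp_def by (rule Bo.seminormed_norm_quot)
  note S = Lp_simps Bochner_Lp_simps Lp_times_class Lp_scale_mem_Bochner
  have "\<exists>\<phi>. is_linear (tensor_space (Lp M p) X) (Bochner_Lp M p X) \<phi> \<and>
    (\<forall>F\<in>carrier (Lp M p). \<forall>x\<in>carrier X. \<phi> (tensor (Lp M p) X F x) = Lp_times M p X F x)"
  proof (rule tensor_universal)
    show "vspace (Lp M p :: ('k, ('s \<Rightarrow> 'k) set) norm_space)" "vspace X" "vspace (Bochner_Lp M p X)"
      by unfold_locales
  next
    fix F :: "('s \<Rightarrow> 'k) set" and x assume "F \<in> carrier (Lp M p)" and x: "x \<in> carrier X"
    then obtain f where f: "Lp_fun p M f" "F = Lp_class M p f"
      by (elim Lp_E)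
    show "Lp_times M p X F x \<in> carrier (Bochner_Lp M p X)"
      using f x by (simp add: S)
    show "Lp_times M p X (vscale (Lp M p) a F) x = vscale (Bochner_Lp M p X) a (Lp_times M p X F x)" for a
      using f x by (simp add: S Lp_fun_mult Bochner_simps(2-) scale_scale)
    show "Lp_times M p X F (vscale X a x) = vscale (Bochner_Lp M p X) a (Lp_times M p X F x)" for a
      using f x by (simp add: S Bochner_simps(2-) scale_scale closed mult.commute)
    show "Lp_times M p X F (vadd X x y) = vadd (Bochner_Lp M p X) (Lp_times M p X F x) (Lp_times M p X F y)"
      if "y \<in> carrier X" for y
      using f x that by (simp add: S Bochner_simps(2-) scale_add closed)
    fix G :: "('s \<Rightarrow> 'k) set" assume "G \<in> carrier (Lp M p)"
    then obtain g where g: "Lp_fun p M g" "G = Lp_class M p g"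
      by (elim Lp_E)
    show "Lp_times M p X (vadd (Lp M p) F G) x = vadd (Bochner_Lp M p X) (Lp_times M p X F x) (Lp_times M p X G x)"
      using f g x p by (simp add: S Lp_fun_add Bochner_simps(2-) add_scale)
  qed
  then have *: "is_linear (tensor_space (Lp M p) X) (Bochner_Lp M p X) (tensor_to_Bochner M p X) \<and>
    (\<forall>F\<in>carrier (Lp M p). \<forall>x\<in>carrier X.
      tensor_to_Bochner M p X (tensor (Lp M p) X F x) = Lp_times M p X F x)"
    unfolding tensor_to_Bochner_def by (rule someI_ex)
  then show "is_linear (tensor_space (Lp M p) X) (Bochner_Lp M p X) (tensor_to_Bochner M p X)"
    by blast
  show "tensor_to_Bochner M p X (tensor (Lp M p) X (Lp_class M p f) x) = B_class (\<lambda>s. vscale X (f s) x)"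
    if "Lp_fun p M f" "x \<in> carrier X"
    using * that by (simp add: Lp_simps Lp_times_class)
qed

lemma seminormed_Delta_tensor: "seminormed (Delta_tensor M p X)"
  unfolding Delta_tensor_def
proof (rule seminormed_pullback[OF vspace_tensor_space _ tensor_to_Bochner(1)])
  show "seminormed (Bochner_Lp M p X)"
    unfolding Bochner_Lp_def by (rule Bo.seminormed_norm_quot)
qed

text \<open>Linearity of the canonical map carries the criterion of the completion over to the
  Bochner space, where it is evaluated on representatives. The second claim expresses that the
  Bochner space is closed under linear combinations; it supplies hypothesis \<open>int\<close> of
  \<open>Lp_tensor_minimal_iff\<close>.\<close>

lemma BJ_Delta_elem_iff:
  assumes "Lp_fun p M f" "Lp_fun p M g" "x \<in> carrier X" "y \<in> carrier X"
  shows "BJ_orthogonal (Delta_completion M p X)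
      (Delta_elem M p X (Lp_class M p f) x) (Delta_elem M p X (Lp_class M p g) y)
    \<longleftrightarrow> (\<forall>\<alpha>. (\<integral>s. vnorm X (vscale X (f s) x) powr p \<partial>M)
        \<le> (\<integral>s. vnorm X (vadd X (vscale X (f s) x) (vscale X (\<alpha> * g s) y)) powr p \<partial>M))" (is ?iff)
    and "integrable M (\<lambda>s. vnorm X (vadd X (vscale X (f s) x) (vscale X (\<alpha> * g s) y)) powr p)"
proof -
  interpret D: seminormed "Delta_tensor M p X"
    by (rule seminormed_Delta_tensor)
  let ?F = "tensor (Lp M p) X (Lp_class M p f) x" and ?G = "tensor (Lp M p) X (Lp_class M p g) y"
  have mem: "Lp_class M p f \<in> carrier (Lp M p)" "Lp_class M p g \<in> carrier (Lp M p)"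
    using assms by (simp_all add: Lp_simps)
  have c: "?F \<in> carrier (tensor_space (Lp M p) X)" "?G \<in> carrier (tensor_space (Lp M p) X)"
    using mem assms by (simp_all add: tensor_closed)
  have c': "?F \<in> carrier (Delta_tensor M p X)" "?G \<in> carrier (Delta_tensor M p X)"
    using c by (simp_all add: Delta_tensor_def with_norm_def)
  note B = Lp_scale_mem_Bochner[OF assms(1,3)] Lp_scale_mem_Bochner[OF assms(2,4)]
  have B2: "(\<lambda>s. vadd X (vscale X (f s) x) (vscale X (\<alpha> * g s) y)) \<in> carrier (Bochner_Lp_funs M p X)" for \<alpha>
    using Bo.add_closed[OF B(1) Bo.scale_closed[OF B(2), of \<alpha>]] assms(4)
    by (simp add: Bochner_simps(2,4) scale_scale)
  then show "integrable M (\<lambda>s. vnorm X (vadd X (vscale X (f s) x) (vscale X (\<alpha> * g s) y)) powr p)"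
    by (simp add: Bochner_simps)
  interpret T: vspace "tensor_space (Lp M p) X"
    by (rule vspace_tensor_space)
  have lin: "tensor_to_Bochner M p X (vadd (tensor_space (Lp M p) X) ?F (vscale (tensor_space (Lp M p) X) \<alpha> ?G))
      = vadd (Bochner_Lp M p X) (tensor_to_Bochner M p X ?F)
          (vscale (Bochner_Lp M p X) \<alpha> (tensor_to_Bochner M p X ?G))" for \<alpha>
    using tensor_to_Bochner(1) c T.scale_closed[OF c(2)] by (simp add: is_linear_def)
  have "vnorm (Delta_tensor M p X) (vadd (Delta_tensor M p X) ?F (vscale (Delta_tensor M p X) \<alpha> ?G))
      = (\<integral>s. vnorm X (vadd X (vscale X (f s) x) (vscale X (\<alpha> * g s) y)) powr p \<partial>M) powr (1 / p)" for \<alpha>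
  proof -
    have "vnorm (Delta_tensor M p X) (vadd (Delta_tensor M p X) ?F (vscale (Delta_tensor M p X) \<alpha> ?G))
        = vnorm (Bochner_Lp M p X) (vadd (Bochner_Lp M p X) (B_class (\<lambda>s. vscale X (f s) x))
          (vscale (Bochner_Lp M p X) \<alpha> (B_class (\<lambda>s. vscale X (g s) y))))"
      using assms by (simp add: Delta_tensor_def with_norm_def lin tensor_to_Bochner(2))
    also have "\<dots> = vnorm (Bochner_Lp_funs M p X) (vadd (Bochner_Lp_funs M p X) (\<lambda>s. vscale X (f s) x)
          (vscale (Bochner_Lp_funs M p X) \<alpha> (\<lambda>s. vscale X (g s) y)))"
      using B by (simp add: Bochner_Lp_simps Bo.closed)
    finally show ?thesis
      using assms(4) by (simp add: Bochner_simps scale_scale)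
  qed
  moreover have "vnorm (Delta_tensor M p X) ?F = (\<integral>s. vnorm X (vscale X (f s) x) powr p \<partial>M) powr (1 / p)"
    using B assms by (simp add: Delta_tensor_def with_norm_def tensor_to_Bochner(2) Bochner_Lp_simps)
      (simp add: Bochner_simps)
  ultimately show ?iff
    unfolding Delta_completion_def Delta_elem_def D.BJ_completion_iff[OF c'] using p
    by (simp add: powr_le_powr_iff)
qed

end

theorem BJ_Delta_iff:
  fixes f1 g1 :: "('s \<Rightarrow> 'k::{real_normed_field, euclidean_space}) set" and f2 g2 :: "('t \<Rightarrow> 'k) set"
  assumes "1 < p" "f1 \<in> carrier (Lp M p)" "g1 \<in> carrier (Lp M p)"
    "f2 \<in> carrier (Lp N p)" "g2 \<in> carrier (Lp N p)"
  shows "BJ_orthogonal (Delta_completion M p (Lp N p))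
      (Delta_elem M p (Lp N p) f1 f2) (Delta_elem M p (Lp N p) g1 g2)
    \<longleftrightarrow> BJ_orthogonal (Lp M p) f1 g1 \<or> BJ_orthogonal (Lp N p) f2 g2"
proof -
  have p: "1 \<le> p" "0 \<le> p" using assms(1) by auto
  obtain F1 where F1: "Lp_fun p M F1" "f1 = Lp_class M p F1"
    using assms(2) by (rule Lp_E)
  obtain G1 where G1: "Lp_fun p M G1" "g1 = Lp_class M p G1"
    using assms(3) by (rule Lp_E)
  obtain F2 where F2: "Lp_fun p N F2" "f2 = Lp_class N p F2"
    using assms(4) by (rule Lp_E)
  obtain G2 where G2: "Lp_fun p N G2" "g2 = Lp_class N p G2"
    using assms(5) by (rule Lp_E)
  interpret LN: seminormed "Lp N p :: ('k, ('t \<Rightarrow> 'k) set) norm_space"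
    by (rule seminormed_Lp[OF p(1)])
  interpret Lp_tensor "Lp N p :: ('k, ('t \<Rightarrow> 'k) set) norm_space" M p
    by unfold_locales (rule p)
  \<comment> \<open>The exponent \<open>p\<close> cancels the root in the norm of
    \<open>Lp N p\<close>, so the integrand over \<open>M\<close> is itself an integral over
    \<open>N\<close>.\<close>
  have f: "vnorm (Lp N p) (vscale (Lp N p) (F1 s) f2) powr p = (\<integral>t. norm (F1 s * F2 t) powr p \<partial>N)" for s
    using p assms(1) F2 by (simp add: vscale_Lp_class vnorm_Lp_class Lp_fun_mult powr_powr)
  have fg: "vnorm (Lp N p) (vadd (Lp N p) (vscale (Lp N p) (F1 s) f2) (vscale (Lp N p) (\<alpha> * G1 s) g2)) powr p
      = (\<integral>t. norm (F1 s * F2 t + \<alpha> * (G1 s * G2 t)) powr p \<partial>N)" for s \<alpha>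
    using p assms(1) F2 G2
    by (simp add: vscale_Lp_class vadd_Lp_class vnorm_Lp_class Lp_fun_mult Lp_fun_add powr_powr mult.assoc)
  note BJ = BJ_Delta_elem_iff[OF F1(1) G1(1) assms(4,5), unfolded f fg]
  have "BJ_orthogonal (Delta_completion M p (Lp N p))
      (Delta_elem M p (Lp N p) f1 f2) (Delta_elem M p (Lp N p) g1 g2)
    \<longleftrightarrow> (\<integral>s. duality p (F1 s) * G1 s \<partial>M) = 0 \<or> (\<integral>t. duality p (F2 t) * G2 t \<partial>N) = 0"
    unfolding F1(2) G1(2) BJ(1)
    by (rule Lp_tensor_minimal_iff[OF assms(1) F1(1) G1(1) F2(1) G2(1) BJ(2)])
  then show ?thesis
    unfolding F1(2) G1(2) F2(2) G2(2)
    by (simp add: BJ_Lp_class_iff p F1(1) G1(1) F2(1) G2(1) Lp_minimal_iff[OF assms(1)])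
qed

theorem theorem3p8:
  fixes M :: "'s measure" and N :: "'t measure" and p :: real
  assumes "1 < p"
  shows
    "(\<forall>(f1 :: ('s \<Rightarrow> real) set) \<in> carrier (Lp M p). \<forall>g1 \<in> carrier (Lp M p).
      \<forall>(f2 :: ('t \<Rightarrow> real) set) \<in> carrier (Lp N p). \<forall>g2 \<in> carrier (Lp N p).
        BJ_orthogonal (Delta_completion M p (Lp N p))
          (Delta_elem M p (Lp N p) f1 f2) (Delta_elem M p (Lp N p) g1 g2)
        \<longleftrightarrow> BJ_orthogonal (Lp M p) f1 g1 \<or> BJ_orthogonal (Lp N p) f2 g2)
     \<and>
     (\<forall>(f1 :: ('s \<Rightarrow> complex) set) \<in> carrier (Lp M p). \<forall>g1 \<in> carrier (Lp M p).
      \<forall>(f2 :: ('t \<Rightarrow> complex) set) \<in> carrier (Lp N p). \<forall>g2 \<in> carrier (Lp N p).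
        BJ_orthogonal (Delta_completion M p (Lp N p))
          (Delta_elem M p (Lp N p) f1 f2) (Delta_elem M p (Lp N p) g1 g2)
        \<longleftrightarrow> BJ_orthogonal (Lp M p) f1 g1 \<or> BJ_orthogonal (Lp N p) f2 g2)"
  by (intro conjI ballI BJ_Delta_iff[OF assms])

end
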